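(* Let $\mathcal{G}$ be a finite injective word labeled oriented graph on vertices $x_1,\ldots,x_n$, and let $P(\mathcal{G})=\langle x_1,\ldots,x_n \mid r_1,\ldots,r_k\rangle$ be the associated WLOG-presentation. Thus each relation $r_i$ is of the form $x_{\alpha(i)}w_i=w_ix_{\beta(i)}$, where $w_i=t_{i,1}\cdots t_{i,s_i}$ is a word with $t_{i,j}\in\{x_1,\ldots,x_n\}^{\pm1}$. Assume $s_i\ge 2$ for $i=1,\ldots,k$, and assume further that: (1) each relator is cyclically reduced; (2) for each relator $r_i$ the words $x_{\alpha(i)}t_{i,1}$, $t_{i,1}^{-1}x_{\alpha(i)}$, $x_{\beta(i)}t_{i,s_i}^{-1}$, $t_{i,s_i}x_{\beta(i)}$ are not pieces (i.e. these words and their inverses are not subwords in another relator or in the same relator at another place); (3) no word $w_i$ has the form $x_j^{\pm m}$ for some $j$ and some $m\ge 2$. Then the standard 2-complex $K(\mathcal{G})$ of the presentation $P(\mathcal{G})$ is diagrammatically reducible (DR).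
   Context: A word labeled oriented graph (WLOG) is an oriented graph $\mathcal{G}$ on vertices $X=\{x_1,\ldots,x_n\}$ in which each oriented edge is labeled by a non-empty word in $X^{\pm1}$. The associated WLOG-presentation $P(\mathcal{G})$ has generators $X$ and relators in one-to-one correspondence with the edges of $\mathcal{G}$: an edge with initial vertex $x_i$, terminal vertex $x_j$ and label $w$ gives the relation $x_iw=wx_j$, i.e. the relator $x_iwx_j^{-1}w^{-1}$. $K(\mathcal{G})$ denotes the standard 2-complex associated with $P(\mathcal{G})$ (one vertex, one edge per generator, one 2-cell per relator attached along the relator). The WLOG $\mathcal{G}$ is called injective if no edge label or its inverse is a subword of the label of any other edge. Subwords of relators in condition (2) are understood in relators read as cyclic words. Each of the four words listed for $r_i$, or its inverse, occurs in the cyclic word $x_{\alpha(i)}w_ix_{\beta(i)}^{-1}w_i^{-1}$ at one of the four places where a letter $x_{\alpha(i)}$ or $x_{\beta(i)}^{-1}$ meets $w_i^{\pm1}$. "At another place" means at a place other than this one. The standard 2-complex $K$ of a finite presentation is called diagrammatically reducible (DR) if there is no reduced spherical diagram $f\colon C\to K$. Here a spherical diagram is a combinatorial map $f\colon C\to K$ (mapping open cells homeomorphically onto open cells) where $C$ is a cell decomposition of the 2-sphere. It is reduced if there is no pair of distinct 2-cells of $C$ sharing an edge $e$ that are mapped by $f$ to the same 2-cell of $K$ as mirror images of each other across $e$ (i.e. by folding over $e$). *)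

theory Defs
  imports "HOL-Library.Sublist" "Graph_Theory.Graph_Theory"
begin

section \<open>Words, relators, pieces\<close>

text \<open>The letter \<open>(x, True)\<close> stands for the generator \<open>x\<close>, and \<open>(x, False)\<close> for its inverse.
  Words are lists of letters and are not freely reduced automatically.\<close>

type_synonym 'x letter = "'x \<times> bool"
type_synonym 'x fword = "'x letter list"

definition inv_letter :: "'x letter \<Rightarrow> 'x letter" where
  "inv_letter l = (fst l, \<not> snd l)"

definition inv_word :: "'x fword \<Rightarrow> 'x fword" where
  "inv_word w = rev (map inv_letter w)"

definition cyclically_reduced :: "'x fword \<Rightarrow> bool" where
  "cyclically_reduced r \<longleftrightarrow>
     (\<forall>p < length r. r ! (Suc p mod length r) \<noteq> inv_letter (r ! p))"

text \<open>Relators are indexed by \<open>rels\<close>: two relators that happen to be the same word still count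
  as two relators.\<close>

record ('x, 'i) presentation =
  gens :: "'x set"
  rels :: "'i set"
  relator :: "'i \<Rightarrow> 'x fword"

text \<open>The cyclic word \<open>r\<close> reads \<open>u\<close> when started at its \<open>p\<close>-th letter.\<close>

definition occurs_at :: "'x fword \<Rightarrow> 'x fword \<Rightarrow> nat \<Rightarrow> bool" where
  "occurs_at u r p \<longleftrightarrow>
     p < length r \<and> (\<forall>k < length u. r ! ((p + k) mod length r) = u ! k)"

definition occurrences :: "('x, 'i) presentation \<Rightarrow> 'x fword \<Rightarrow> ('i \<times> nat) set" where
  "occurrences P u = {(i, p). i \<in> rels P \<and>
     (occurs_at u (relator P i) p \<or> occurs_at (inv_word u) (relator P i) p)}"

text \<open>A piece is a word that occurs, up to inversion, at two different places: in two relators, or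
  at two positions of one (cyclic) relator.\<close>

definition piece :: "('x, 'i) presentation \<Rightarrow> 'x fword \<Rightarrow> bool" where
  "piece P u \<longleftrightarrow> (\<exists>a \<in> occurrences P u. \<exists>b \<in> occurrences P u. a \<noteq> b)"


section \<open>Combinatorial 2-complexes\<close>

text \<open>The 1-skeleton is a graph in the sense of Serre: every geometric edge is a pair
  \<open>{e, rev_arc e}\<close> of oppositely oriented arcs. The 2-cell \<open>c\<close> is attached along the closed
  path \<open>bdry c\<close>, which comes with a starting point and a direction. Attaching paths are not
  allowed to be constant.\<close>

record ('v, 'e, 'c) complex2 =
  skel :: "('v, 'e) pre_digraph"
  rev_arc :: "'e \<Rightarrow> 'e"
  cells :: "'c set"
  bdry :: "'c \<Rightarrow> 'e list"

definition is_complex2 :: "('v, 'e, 'c) complex2 \<Rightarrow> bool" where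
  "is_complex2 C \<longleftrightarrow>
     bidirected_digraph (skel C) (rev_arc C) \<and>
     (\<forall>c \<in> cells C. bdry C c \<noteq> [] \<and> (\<exists>v. pre_digraph.awalk (skel C) v (bdry C c) v))"

definition geom_edges :: "('v, 'e, 'c) complex2 \<Rightarrow> 'e set set" where
  "geom_edges C = (\<lambda>e. {e, rev_arc C e}) ` arcs (skel C)"

definition sides :: "('v, 'e, 'c) complex2 \<Rightarrow> ('c \<times> nat) set" where
  "sides C = {(c, p). c \<in> cells C \<and> p < length (bdry C c)}"

definition finite_complex2 :: "('v, 'e, 'c) complex2 \<Rightarrow> bool" where
  "finite_complex2 C \<longleftrightarrow>
     finite (verts (skel C)) \<and> finite (arcs (skel C)) \<and> finite (cells C)"

definition euler_char :: "('v, 'e, 'c) complex2 \<Rightarrow> int" where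
  "euler_char C =
     int (card (verts (skel C))) - int (card (geom_edges C)) + int (card (cells C))"

text \<open>The link of a vertex \<open>v\<close> has the arcs starting at \<open>v\<close> as its vertices. Its edges are the
  corners of 2-cells at \<open>v\<close>: the corner between the sides \<open>p\<close> and \<open>p + 1\<close> of \<open>c\<close> joins the
  reverse of the former to the latter.\<close>

definition link_rel :: "('v, 'e, 'c) complex2 \<Rightarrow> ('e \<times> 'e) set" where
  "link_rel C = (\<lambda>(c, p). (rev_arc C (bdry C c ! p), bdry C c ! (Suc p mod length (bdry C c))))
     ` sides C"

text \<open>A finite 2-complex (without isolated vertices) is a closed surface iff all vertex links are circles. The first condition
  (each geometric edge is traversed exactly twice by the boundaries of the 2-cells) says that
  the links are 2-regular, the second one that they are connected.\<close>

definition closed_surface :: "('v, 'e, 'c) complex2 \<Rightarrow> bool" where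
  "closed_surface C \<longleftrightarrow> is_complex2 C \<and> finite_complex2 C \<and>
     (\<forall>e \<in> arcs (skel C). card {(c, p) \<in> sides C. bdry C c ! p \<in> {e, rev_arc C e}} = 2) \<and>
     (\<forall>v \<in> verts (skel C). \<forall>e \<in> out_arcs (skel C) v. \<forall>e' \<in> out_arcs (skel C) v.
        (e, e') \<in> (link_rel C \<union> (link_rel C)\<inverse>)\<^sup>*)"

text \<open>By the classification of surfaces, the connected closed surfaces of Euler characteristic 2 are
  exactly the cell decompositions of the 2-sphere (other than the one without edges, whose 2-cell
  is attached along a constant path).\<close>

definition sphere_decomposition :: "('v, 'e, 'c) complex2 \<Rightarrow> bool" where
  "sphere_decomposition C \<longleftrightarrow>
     closed_surface C \<and> Digraph_Component.connected (skel C) \<and> euler_char C = 2"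


section \<open>Combinatorial maps and diagrammatic reducibility\<close>

text \<open>A combinatorial map sends the interior of a 2-cell \<open>c\<close> homeomorphically onto that of
  \<open>on_cells c\<close>. On the boundary this is a rotation or a reflection of polygons: side 0 of \<open>c\<close>
  goes to side \<open>shift c\<close> of the image cell, and the sides are then run through in the same
  direction if \<open>keeps_orient c\<close> holds, and in the opposite direction otherwise.\<close>

record ('v, 'e, 'c, 'v2, 'e2, 'c2) cell_map =
  on_verts :: "'v \<Rightarrow> 'v2"
  on_arcs :: "'e \<Rightarrow> 'e2"
  on_cells :: "'c \<Rightarrow> 'c2"
  shift :: "'c \<Rightarrow> nat"
  keeps_orient :: "'c \<Rightarrow> bool"

definition side_image ::
  "('v, 'e, 'c, 'v2, 'e2, 'c2) cell_map \<Rightarrow> ('v, 'e, 'c) complex2 \<Rightarrow> 'c \<Rightarrow> nat \<Rightarrow> nat" where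
  "side_image f C c p = (let n = length (bdry C c) in
     if keeps_orient f c then (shift f c + p) mod n else (shift f c + (n - p)) mod n)"

definition combinatorial_map ::
  "('v, 'e, 'c, 'v2, 'e2, 'c2) cell_map \<Rightarrow> ('v, 'e, 'c) complex2 \<Rightarrow>
   ('v2, 'e2, 'c2) complex2 \<Rightarrow> bool" where
  "combinatorial_map f C K \<longleftrightarrow>
     (\<forall>v \<in> verts (skel C). on_verts f v \<in> verts (skel K)) \<and>
     (\<forall>e \<in> arcs (skel C). on_arcs f e \<in> arcs (skel K) \<and>
        tail (skel K) (on_arcs f e) = on_verts f (tail (skel C) e) \<and>
        head (skel K) (on_arcs f e) = on_verts f (head (skel C) e) \<and>
        on_arcs f (rev_arc C e) = rev_arc K (on_arcs f e)) \<and>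
     (\<forall>c \<in> cells C. on_cells f c \<in> cells K \<and>
        length (bdry K (on_cells f c)) = length (bdry C c) \<and>
        (\<forall>p < length (bdry C c).
           let e = bdry K (on_cells f c) ! side_image f C c p
           in on_arcs f (bdry C c ! p) = (if keeps_orient f c then e else rev_arc K e)))"

text \<open>Two distinct 2-cells sharing an edge are mirror images across it iff they have the same image
  and both their sides along the edge go to the same side of the image cell (the edge itself has
  only one image, so the orientations then match automatically).\<close>

definition reduced_map ::
  "('v, 'e, 'c, 'v2, 'e2, 'c2) cell_map \<Rightarrow> ('v, 'e, 'c) complex2 \<Rightarrow> bool" where
  "reduced_map f C \<longleftrightarrow>
     \<not> (\<exists>(c, p) \<in> sides C. \<exists>(c', p') \<in> sides C. c \<noteq> c' \<and>
          bdry C c' ! p' \<in> {bdry C c ! p, rev_arc C (bdry C c ! p)} \<and>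
          on_cells f c = on_cells f c' \<and> side_image f C c p = side_image f C c' p')"

text \<open>Cell decompositions of the sphere are finite, so it does not matter that their cells are named
  by natural numbers.\<close>

definition diagrammatically_reducible :: "('v, 'e, 'c) complex2 \<Rightarrow> bool" where
  "diagrammatically_reducible K \<longleftrightarrow>
     \<not> (\<exists>(C :: (nat, nat, nat) complex2) (f :: (nat, nat, nat, 'v, 'e, 'c) cell_map).
          sphere_decomposition C \<and> combinatorial_map f C K \<and> reduced_map f C)"

text \<open>The arcs of the standard complex are the letters. Reversal is required to be the identity
  outside the arcs by the library's notion of a bidirected graph.\<close>

definition standard_complex ::
  "('x, 'i) presentation \<Rightarrow> (unit, 'x letter, 'i) complex2" where
  "standard_complex P =
     \<lparr> skel = \<lparr> verts = {()}, arcs = gens P \<times> UNIV, tail = (\<lambda>_. ()), head = (\<lambda>_. ()) \<rparr>,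
       rev_arc = (\<lambda>l. if fst l \<in> gens P then inv_letter l else l),
       cells = rels P,
       bdry = relator P \<rparr>"


section \<open>Word labeled oriented graphs\<close>

record ('x, 'e) word_labeled_graph =
  graph_of :: "('x, 'e) pre_digraph"
  label :: "'e \<Rightarrow> 'x fword"

definition is_wlog :: "('x, 'e) word_labeled_graph \<Rightarrow> bool" where
  "is_wlog G \<longleftrightarrow> fin_digraph (graph_of G) \<and>
     (\<forall>e \<in> arcs (graph_of G). label G e \<noteq> [] \<and> fst ` set (label G e) \<subseteq> verts (graph_of G))"

definition initial_letter :: "('x, 'e) word_labeled_graph \<Rightarrow> 'e \<Rightarrow> 'x letter" where
  "initial_letter G e = (tail (graph_of G) e, True)"

definition terminal_letter :: "('x, 'e) word_labeled_graph \<Rightarrow> 'e \<Rightarrow> 'x letter" where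
  "terminal_letter G e = (head (graph_of G) e, True)"

definition wlog_relator :: "('x, 'e) word_labeled_graph \<Rightarrow> 'e \<Rightarrow> 'x fword" where
  "wlog_relator G e =
     [initial_letter G e] @ label G e @ [inv_letter (terminal_letter G e)] @ inv_word (label G e)"

definition wlog_presentation :: "('x, 'e) word_labeled_graph \<Rightarrow> ('x, 'e) presentation" where
  "wlog_presentation G =
     \<lparr> gens = verts (graph_of G), rels = arcs (graph_of G), relator = wlog_relator G \<rparr>"

definition injective_wlog :: "('x, 'e) word_labeled_graph \<Rightarrow> bool" where
  "injective_wlog G \<longleftrightarrow>
     (\<forall>e \<in> arcs (graph_of G). \<forall>e' \<in> arcs (graph_of G). e \<noteq> e' \<longrightarrow>
        \<not> sublist (label G e) (label G e') \<and> \<not> sublist (inv_word (label G e)) (label G e'))"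

lemma is_complex2_standard_complex:
  assumes "\<And>i. i \<in> rels P \<Longrightarrow> relator P i \<noteq> [] \<and> fst ` set (relator P i) \<subseteq> gens P"
  shows "is_complex2 (standard_complex P)"
proof -
  let ?S = "skel (standard_complex P)"
  have S: "verts ?S = {()}" "arcs ?S = gens P \<times> UNIV"
    by (simp_all add: standard_complex_def)
  have cas: "pre_digraph.cas ?S u es v" for u v es
    by (induction es arbitrary: u) (simp_all add: pre_digraph.cas.simps)
  have "bidirected_digraph ?S (rev_arc (standard_complex P))"
    by unfold_locales (auto simp: standard_complex_def inv_letter_def prod_eq_iff)
  moreover have "pre_digraph.awalk ?S () (relator P i) ()" if "i \<in> rels P" for i
    using assms[OF that] by (auto simp: pre_digraph.awalk_def S cas)
  ultimately show ?thesis
    using assms by (auto simp: is_complex2_def standard_complex_def)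
qed

end

theory Submission
  imports Defs
begin

text \<open>
  Suppose that a reduced spherical diagram exists. Each of its 2-cells reads a relator
  \<open>x w y\<^sup>-\<^sup>1 w\<^sup>-\<^sup>1\<close>, so its boundary consists of two single edges, the rungs \<open>x\<close> and \<open>y\<close>, and
  two blocks reading \<open>w\<close> and \<open>w\<^sup>-\<^sup>1\<close>. The four corners between a rung and a block are called special.
  The contradiction is that the diagram carries angles for which no vertex and no 2-cell is
  positively curved, so that its Euler characteristic cannot be positive.

  Two corners at a vertex of degree 2 read, up to inversion, the same word of length 2, and they
  read it at different places because the diagram is reduced. That word is therefore a piece
  (\<open>deg_2_imp_piece\<close>). As special corners do not read pieces, they lie at vertices of degree
  at least 3. Call a block full if all its inner vertices have degree 2. The 2-cell on the other
  side of a full block is then the same along the whole block and meets no special corner there,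
  so the label is a subword of a label or of an inverse label. By injectivity both cells have the
  same relator and share an entire block, and by reducedness it is \<open>w\<close> for one cell and \<open>w\<^sup>-\<^sup>1\<close> for
  the other (\<open>full_block_partner\<close>): the cells are stacked on each other, with their rungs in line.

  The weight of a corner is its exterior angle in units of \<open>\<pi>/6\<close>. Special corners at the ends
  of a full block have weight 3 (a right angle), the other special corners weight 2. A corner inside
  a block has weight 0 (a straight angle) if its vertex has degree 2, or if its vertex has degree 3
  and carries a special corner of a full block; otherwise it has weight 2. With these weights the
  angles at a vertex of degree \<open>d\<close> add up to at least a full turn, that is, the weights add up to at
  most \<open>6 d - 12\<close> (\<open>vertex_weight\<close>). In a 2-cell each of the two blocks, taken with its two
  special corners, has weight at least 6 (\<open>block_weight\<close>), hence the exterior angles add up to at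
  least a full turn. Counting corners turns these estimates into the Euler characteristic being at
  most 0 (\<open>combinatorial_gauss_bonnet\<close>).

  For a full block the estimate is \<open>3 + 3\<close>. For another block it is \<open>2 + 2 + 2\<close>, provided that some
  inner corner has positive weight (\<open>split_block_weight\<close>). Suppose none has. At an inner vertex of
  degree at least 3 the other two corners belong to two stacked cells, whose rungs are the two
  adjacent edges of the block. These rungs carry the same letter, and their other ends are again
  of degree at least 3. So the situation spreads along the whole block, which makes \<open>w\<close> a power
  of a single letter, against the last hypothesis.
\<close>

section \<open>Words and pieces\<close>

lemma inv_letter_inv_letter [simp]: "inv_letter (inv_letter l) = l"
  by (simp add: inv_letter_def)

lemma inv_letter_neq [simp]: "inv_letter l \<noteq> l" "l \<noteq> inv_letter l"
  by (auto simp: inv_letter_def prod_eq_iff)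

lemma inv_letter_eq_iff [simp]: "inv_letter l = inv_letter m \<longleftrightarrow> l = m"
  by (metis inv_letter_inv_letter)

lemma length_inv_word [simp]: "length (inv_word w) = length w"
  by (simp add: inv_word_def)

lemma nth_inv_word: "k < length w \<Longrightarrow> inv_word w ! k = inv_letter (w ! (length w - Suc k))"
  by (simp add: inv_word_def rev_nth)

lemma inv_word_inv_word [simp]: "inv_word (inv_word w) = w"
  by (simp add: inv_word_def rev_map comp_def)

lemma inv_word_pair: "inv_word [a, b] = [inv_letter b, inv_letter a]"
  by (simp add: inv_word_def)

lemma sublist_inv_word [simp]: "sublist (inv_word u) (inv_word v) \<longleftrightarrow> sublist u v"
proof -
  have "sublist (inv_word u) (inv_word v)" if "sublist u v" for u v :: "'a fword"
    using map_mono_sublist[OF that] by (simp add: inv_word_def sublist_rev)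
  from this[of u v] this[of "inv_word u" "inv_word v"] show ?thesis by auto
qed

lemma piece_inv_word: "piece P (inv_word u) \<longleftrightarrow> piece P u"
proof -
  have "occurrences P (inv_word u) = occurrences P u"
    by (auto simp: occurrences_def)
  then show ?thesis by (simp add: piece_def)
qed

lemma occurrences_pair:
  "(i, q) \<in> occurrences P [a, b] \<longleftrightarrow>
     i \<in> rels P \<and> q < length (relator P i) \<and>
     (relator P i ! q = a \<and> relator P i ! (Suc q mod length (relator P i)) = b \<or>
      relator P i ! q = inv_letter b \<and>
      relator P i ! (Suc q mod length (relator P i)) = inv_letter a)"
  by (auto simp: occurrences_def occurs_at_def inv_word_pair less_Suc_eq)

lemma sublist_if_nth:
  assumes "off + length xs \<le> length ys"
    and "\<And>k. k < length xs \<Longrightarrow> xs ! k = ys ! (off + k)"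
  shows "sublist xs ys"
proof -
  have "xs = take (length xs) (drop off ys)"
    using assms by (intro nth_equalityI) auto
  then show ?thesis
    by (metis sublist_drop sublist_order.order_trans sublist_take)
qed

text \<open>The middle letter of a self-inverse word of odd length would be its own inverse, which is
  impossible; in even length the two middle letters are inverse to each other.\<close>

lemma self_inverse_word_cancels:
  assumes "inv_word w = w" "w \<noteq> []"
  shows "\<exists>k. Suc k < length w \<and> w ! Suc k = inv_letter (w ! k)"
proof -
  let ?n = "length w"
  have sym: "w ! k = inv_letter (w ! (?n - Suc k))" if "k < ?n" for k
    using nth_inv_word[OF that] assms(1) by simp
  show ?thesis
  proof (cases "even ?n")
    case True
    then obtain m where m: "?n = 2 * m" by blast
    with assms(2) obtain k where k: "m = Suc k" by (cases m) auto
    have "w ! Suc k = inv_letter (w ! k)" using sym[of "Suc k"] m k by simp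
    moreover have "Suc k < length w" using m k by simp
    ultimately show ?thesis by blast
  next
    case False
    then obtain m where m: "?n = 2 * m + 1" using oddE by blast
    have "w ! m = inv_letter (w ! m)" using sym[of m] m by simp
    then show ?thesis by simp
  qed
qed

section \<open>The relators of a word labeled oriented graph\<close>

locale wlog_conditions =
  fixes G :: "('x, 'e) word_labeled_graph"
  assumes injective: "injective_wlog G"
    and label_length: "\<And>i. i \<in> arcs (graph_of G) \<Longrightarrow> length (label G i) \<ge> 2"
    and reduced_relator: "\<And>i. i \<in> arcs (graph_of G) \<Longrightarrow> cyclically_reduced (wlog_relator G i)"
    and no_piece: "\<And>i. i \<in> arcs (graph_of G) \<Longrightarrow>
           \<not> piece (wlog_presentation G) [initial_letter G i, hd (label G i)] \<and>
           \<not> piece (wlog_presentation G) [inv_letter (hd (label G i)), initial_letter G i] \<and>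
           \<not> piece (wlog_presentation G) [terminal_letter G i, inv_letter (last (label G i))] \<and>
           \<not> piece (wlog_presentation G) [last (label G i), terminal_letter G i]"
    and no_power: "\<And>i x s m. i \<in> arcs (graph_of G) \<Longrightarrow> m \<ge> 2 \<Longrightarrow>
           label G i \<noteq> replicate m (x, s)"
begin

abbreviation "I \<equiv> arcs (graph_of G)"
abbreviation "R \<equiv> wlog_relator G"

text \<open>The relator has length \<open>2 * half i\<close>. Its rungs are the letters at the positions 0 and \<open>half i\<close>,
  that is, at the multiples of \<open>half i\<close>. The letters between two rungs form block 0, which reads the
  label, and block 1, which reads the inverse label.\<close>

definition half :: "'e \<Rightarrow> nat" where
  "half i = Suc (length (label G i))"

text \<open>Corner \<open>q\<close> of a relator lies between its letters \<open>q\<close> and \<open>q + 1\<close> (cyclically). It is special if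
  one of these letters is a rung.\<close>

definition special :: "'e \<Rightarrow> nat \<Rightarrow> bool" where
  "special i q \<longleftrightarrow> q mod half i = 0 \<or> Suc q mod half i = 0"

definition block :: "'e \<Rightarrow> nat \<Rightarrow> 'x fword" where
  "block i j = (if j = 0 then label G i else inv_word (label G i))"

lemma presentation_simps [simp]:
  "rels (wlog_presentation G) = I" "relator (wlog_presentation G) = R"
  by (simp_all add: wlog_presentation_def)

lemma half_ge: "i \<in> I \<Longrightarrow> half i \<ge> 3"
  using label_length[of i] by (simp add: half_def)

lemma half_pos [simp]: "0 < half i"
  by (simp add: half_def)

lemma length_R [simp]: "length (R i) = 2 * half i"
  by (simp add: wlog_relator_def half_def)

lemma length_block [simp]: "length (block i j) = half i - 1"
  by (simp add: block_def half_def)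

lemma R_0: "R i ! 0 = initial_letter G i"
  by (simp add: wlog_relator_def)

lemma R_half: "R i ! half i = inv_letter (terminal_letter G i)"
  by (simp add: wlog_relator_def half_def nth_append)

lemma R_block:
  assumes "j < 2" "Suc k < half i"
  shows "R i ! (j * half i + Suc k) = block i j ! k"
proof -
  have "j = 0 \<or> j = 1" using assms by auto
  then show ?thesis
    using assms(2) by (auto simp: wlog_relator_def half_def block_def nth_append)
qed

lemma inv_word_block: "j < 2 \<Longrightarrow> inv_word (block i j) = block i (1 - j)"
  by (auto simp: block_def less_2_cases_iff)

text \<open>Both blocks spell the label, in opposite directions. This symmetry transfers statements about the
  corners of one block to those of the other.\<close>

lemma R_mirror:
  assumes "0 < m" "m < half i"
  shows "R i ! (half i + (half i - m)) = inv_letter (R i ! m)"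
proof -
  obtain k where k: "m = Suc k" using assms by (cases m) auto
  have "R i ! (1 * half i + Suc (half i - m - 1)) = block i 1 ! (half i - m - 1)"
    using assms by (intro R_block) auto
  moreover have "1 * half i + Suc (half i - m - 1) = half i + (half i - m)" using assms by simp
  moreover have "block i 1 ! (half i - m - 1) = inv_letter (block i 0 ! k)"
    using assms k by (simp add: block_def half_def nth_inv_word)
  moreover have "R i ! (0 * half i + Suc k) = block i 0 ! k"
    using assms k by (intro R_block) auto
  ultimately show ?thesis using k by (metis add_0 mult_0)
qed

lemma R_reduced:
  assumes "i \<in> I" "q < 2 * half i"
  shows "R i ! (Suc q mod (2 * half i)) \<noteq> inv_letter (R i ! q)"
  using reduced_relator[OF assms(1)] assms(2) by (simp add: cyclically_reduced_def)

lemma special_cases: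
  assumes "special i q" "q < 2 * half i"
  obtains "q = 0" | "q = half i - 1" | "q = half i" | "q = 2 * half i - 1"
proof -
  have *: "n = 0 \<or> n = half i \<or> n = 2 * half i" if "n mod half i = 0" "n \<le> 2 * half i" for n
  proof -
    from that(1) obtain k where k: "n = half i * k" by blast
    with that(2) have "k \<le> 2" by (simp add: mult.commute)
    then have "k = 0 \<or> k = 1 \<or> k = 2" by auto
    then show ?thesis using k by auto
  qed
  have "q = 0 \<or> q = half i - 1 \<or> q = half i \<or> q = 2 * half i - 1"
    using assms *[of q] *[of "Suc q"] half_pos[of i] unfolding special_def by auto
  then show ?thesis using that by auto
qed

text \<open>Each of the four special corners reads, up to inversion, one of the four words that are assumed
  not to be pieces.\<close>

lemma special_not_piece:
  assumes i: "i \<in> I" and q: "q < 2 * half i" and sp: "special i q"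
  shows "\<not> piece (wlog_presentation G) [R i ! q, R i ! (Suc q mod (2 * half i))]"
proof -
  let ?s = "length (label G i)"
  have s: "?s \<ge> 2" using label_length[OF i] .
  then have ne: "label G i \<noteq> []" by auto
  have first: "R i ! 1 = hd (label G i)"
    using R_block[of 0 0 i] s ne by (simp add: half_def block_def hd_conv_nth)
  have last: "R i ! (half i - 1) = last (label G i)"
  proof -
    obtain k where k: "?s = Suc k" using s by (cases ?s) auto
    then show ?thesis
      using R_block[of 0 k i] ne by (simp add: half_def block_def last_conv_nth)
  qed
  have last': "R i ! Suc (half i) = inv_letter (last (label G i))"
    using R_mirror[of "half i - 1" i] last half_ge[OF i] by simp
  have first': "R i ! (2 * half i - 1) = inv_letter (hd (label G i))"
  proof -
    have "half i + (half i - 1) = 2 * half i - 1" using half_ge[OF i] by simp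
    then show ?thesis using R_mirror[of 1 i] first half_ge[OF i] by simp
  qed
  from sp q show ?thesis
  proof (cases rule: special_cases)
    case 1
    then show ?thesis using no_piece[OF i] R_0[of i] first half_ge[OF i] by simp
  next
    case 2
    have "inv_word [R i ! (half i - 1), R i ! half i] =
          [terminal_letter G i, inv_letter (last (label G i))]"
      using last by (simp add: inv_word_pair R_half)
    then have "\<not> piece (wlog_presentation G) [R i ! (half i - 1), R i ! half i]"
      using no_piece[OF i] by (metis piece_inv_word)
    then show ?thesis using 2 half_ge[OF i] by simp
  next
    case 3
    have "inv_word [R i ! half i, R i ! Suc (half i)] =
          [last (label G i), terminal_letter G i]"
      by (simp add: inv_word_pair last' R_half)
    then have "\<not> piece (wlog_presentation G) [R i ! half i, R i ! Suc (half i)]"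
      using no_piece[OF i] by (metis piece_inv_word)
    then show ?thesis using 3 half_ge[OF i] by simp
  next
    case 4
    have "Suc q mod (2 * half i) = 0" using 4 half_ge[OF i] by simp
    then show ?thesis using no_piece[OF i] 4 first' R_0[of i] by simp
  qed
qed

text \<open>If a rung \<open>x\<close> were followed by the first letter \<open>x\<close> of the label, then \<open>x\<close> would be preceded by
  \<open>x\<^sup>-\<^sup>1\<close>, the last letter of the inverse label, and the relator would not be cyclically reduced.\<close>

lemma special_letters_distinct:
  assumes i: "i \<in> I" and q: "q < 2 * half i" and sp: "special i q"
  shows "R i ! (Suc q mod (2 * half i)) \<noteq> R i ! q"
proof -
  have h: "half i \<ge> 3" using half_ge[OF i] .
  have sum: "half i + (half i - 1) = 2 * half i - 1" "half i + (half i - (half i - 1)) = Suc (half i)"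
    using h by auto
  have m1: "R i ! (2 * half i - 1) = inv_letter (R i ! 1)"
    using R_mirror[of 1 i] h sum by simp
  have m2: "R i ! Suc (half i) = inv_letter (R i ! (half i - 1))"
    using R_mirror[of "half i - 1" i] h sum by simp
  note red = R_reduced[OF i]
  from sp q show ?thesis
  proof (cases rule: special_cases)
    case 1
    then show ?thesis using red[of "2 * half i - 1"] m1 h by auto
  next
    case 2
    then show ?thesis using red[of "half i"] m2 h by auto
  next
    case 3
    have "R i ! half i \<noteq> inv_letter (R i ! (half i - 1))"
      using red[of "half i - 1"] h by simp
    then show ?thesis using 3 m2 h by auto
  next
    case 4
    then show ?thesis using red[of 0] m1 h by auto
  qed
qed

lemma block_sublist_imp_eq:
  assumes "i \<in> I" "i' \<in> I" "j < 2" "j' < 2"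
    and "sublist (block i j) (block i' j') \<or> sublist (inv_word (block i j)) (block i' j')"
  shows "i = i'"
proof (rule ccontr)
  assume "i \<noteq> i'"
  then have no: "\<not> sublist (label G i) (label G i')" "\<not> sublist (inv_word (label G i)) (label G i')"
    using injective assms by (auto simp: injective_wlog_def)
  moreover have "sublist (label G i) (inv_word (label G i')) \<longleftrightarrow>
      sublist (inv_word (label G i)) (label G i')"
    by (metis inv_word_inv_word sublist_inv_word)
  ultimately show False using assms(3-5) by (auto simp: block_def split: if_splits)
qed

text \<open>A label that equals its own inverse would contain a cancelling pair.\<close>

lemma block_neq_other:
  assumes i: "i \<in> I"
  shows "block i 0 \<noteq> block i 1"
proof
  assume "block i 0 = block i 1"
  then have "inv_word (label G i) = label G i" by (simp add: block_def)
  moreover have "label G i \<noteq> []" using label_length[OF i] by auto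
  ultimately obtain k where k: "Suc k < length (label G i)"
      "label G i ! Suc k = inv_letter (label G i ! k)"
    using self_inverse_word_cancels by blast
  have "R i ! Suc (Suc k) = inv_letter (R i ! Suc k)"
    using R_block[of 0 k i] R_block[of 0 "Suc k" i] k by (simp add: half_def block_def)
  then show False using R_reduced[OF i, of "Suc k"] k(1) by (simp add: half_def)
qed

lemma block_not_constant:
  assumes i: "i \<in> I"
  shows "\<exists>k. Suc k < half i - 1 \<and> block i j ! Suc k \<noteq> block i j ! k"
proof (rule ccontr)
  assume con: "\<not> ?thesis"
  let ?w = "label G i" let ?n = "length ?w"
  have eq: "block i j ! k = block i j ! 0" if "k < ?n" for k
    using that
  proof (induction k)
    case (Suc k)
    then show ?case using con by (auto simp: half_def)
  qed simp
  have "?w ! k = ?w ! 0" if "k < ?n" for k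
  proof (cases "j = 0")
    case True
    then show ?thesis using eq[OF that] by (simp add: block_def)
  next
    case False
    have b: "block i j = inv_word ?w" using False by (simp add: block_def)
    have rewr: "?w ! k = inv_letter (block i j ! (?n - Suc k))" if "k < ?n" for k
      using that by (simp add: b nth_inv_word)
    have "?w ! l = inv_letter (block i j ! 0)" if "l < ?n" for l
      using rewr[OF that] eq[of "?n - Suc l"] that by simp
    then show ?thesis using that by (metis gr_zeroI less_zeroE)
  qed
  then have "?w = replicate ?n (fst (?w ! 0), snd (?w ! 0))"
    by (intro nth_equalityI) auto
  then show False using no_power[OF i label_length[OF i]] by blast
qed

lemma mod_not_special:
  assumes "\<not> special i q"
  shows "Suc q mod half i = Suc (q mod half i)" "Suc q div half i = q div half i"
    "0 < q mod half i" "Suc (q mod half i) < half i"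
proof -
  have "Suc q mod half i \<noteq> 0" "q mod half i \<noteq> 0" using assms by (auto simp: special_def)
  then show s: "Suc q mod half i = Suc (q mod half i)" "Suc q div half i = q div half i"
      "0 < q mod half i"
    by (auto simp: mod_Suc div_Suc split: if_splits)
  then show "Suc (q mod half i) < half i"
    by (metis half_pos mod_less_divisor)
qed

lemma not_special_offset:
  assumes "0 < m" "Suc m < half i"
  shows "\<not> special i (j * half i + m)"
proof -
  have "Suc (j * half i + m) mod half i = Suc m mod half i"
    by (metis add_Suc_right mod_mult_self3)
  then show ?thesis using assms by (simp add: special_def)
qed

lemma not_special_Suc_less:
  assumes "\<not> special i q" "q < 2 * half i"
  shows "Suc q < 2 * half i"
  using assms by (metis Suc_lessI mod_mult_self2_is_0 special_def)

text \<open>A stretch of the relator without special corners contains no rung, so it lies inside one block.\<close>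

lemma not_special_run:
  assumes "0 < K" "\<And>k. k < K \<Longrightarrow> \<not> special i (b + k)" "b + K < 2 * half i"
  obtains j off where "j < 2" "Suc (off + K) < half i" "\<And>k. k \<le> K \<Longrightarrow> b + k = j * half i + Suc (off + k)"
proof -
  let ?h = "half i"
  have run: "(b + k) div ?h = b div ?h \<and> (b + k) mod ?h = b mod ?h + k" if "k \<le> K" for k
    using that
  proof (induction k)
    case (Suc k)
    then have "\<not> special i (b + k)" using assms(2) by simp
    then show ?case using mod_not_special[of i "b + k"] Suc by simp
  qed simp
  have pos: "0 < b mod ?h" using mod_not_special(3)[of i b] assms(1) assms(2)[of 0] by simp
  have j: "b div ?h < 2" using assms(3) by (simp add: div_less_iff_less_mult)
  have "b mod ?h + K < ?h" using run[of K] by (metis half_pos le_refl mod_less_divisor)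
  moreover have "b + k = b div ?h * ?h + Suc (b mod ?h - 1 + k)" for k
    using pos by (metis Suc_diff_1 add.assoc add_Suc div_mult_mod_eq)
  ultimately show ?thesis using that[of "b div ?h" "b mod ?h - 1"] j pos by simp
qed

end

section \<open>Vertex links of labelled diagrams\<close>

lemma card_2_other:
  assumes "card A = 2" "x \<in> A"
  obtains y where "A = {x, y}" "y \<noteq> x"
proof -
  obtain a b where "A = {a, b}" "a \<noteq> b" using assms(1) unfolding card_2_iff by blast
  then show ?thesis using that[of a] that[of b] assms(2) by blast
qed

text \<open>A labelled diagram records a reduced map from a closed surface to the standard complex of \<open>P\<close> by
  the letters of the arcs and the relators of the 2-cells. Every boundary path is rewritten so that
  its \<open>q\<close>-th side maps to the \<open>q\<close>-th letter of the relator. This absorbs the orientations of the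
  2-cells, and reducedness becomes the statement that two cells with the same relator do not
  share an edge at the same position.\<close>

locale labelled_diagram = bidirected_digraph T rv
  for T :: "('v, 'a) pre_digraph" and rv :: "'a \<Rightarrow> 'a" +
  fixes P :: "('x, 'i) presentation"
    and F :: "'c set" and bd :: "'c \<Rightarrow> 'a list"
    and lt :: "'a \<Rightarrow> 'x letter" and cell_rel :: "'c \<Rightarrow> 'i"
  assumes finite_T: "finite (verts T)" "finite (arcs T)" and finite_F: "finite F"
    and cell_rel: "c \<in> F \<Longrightarrow> cell_rel c \<in> rels P"
    and reads: "c \<in> F \<Longrightarrow> map lt (bd c) = relator P (cell_rel c)"
    and bd_nonempty: "c \<in> F \<Longrightarrow> bd c \<noteq> []"
    and bd_arcs: "c \<in> F \<Longrightarrow> set (bd c) \<subseteq> arcs T"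
    and bd_closed: "c \<in> F \<Longrightarrow> q < length (bd c) \<Longrightarrow>
      head T (bd c ! q) = tail T (bd c ! (Suc q mod length (bd c)))"
    and two_sides: "a \<in> arcs T \<Longrightarrow>
      card {(c, q). c \<in> F \<and> q < length (bd c) \<and> bd c ! q \<in> {a, rv a}} = 2"
    and no_fold: "c \<in> F \<Longrightarrow> c' \<in> F \<Longrightarrow> cell_rel c = cell_rel c' \<Longrightarrow> q < length (bd c) \<Longrightarrow>
      bd c' ! q \<in> {bd c ! q, rv (bd c ! q)} \<Longrightarrow> c = c'"
    and lt_rv: "a \<in> arcs T \<Longrightarrow> lt (rv a) = inv_letter (lt a)"
    and relators_reduced: "i \<in> rels P \<Longrightarrow> cyclically_reduced (relator P i)"
begin

text \<open>The pair \<open>(c, q)\<close> names the side \<open>q\<close> of the 2-cell \<open>c\<close> as well as the corner between this side and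
  the next one. The corner lies at the end of the side, and \<open>ends\<close> are the two arcs leaving its
  vertex along the cell, i.e. the ends of the corresponding edge of the link.\<close>

definition corners :: "('c \<times> nat) set" where
  "corners = {(c, q). c \<in> F \<and> q < length (bd c)}"

definition side :: "'c \<times> nat \<Rightarrow> 'a" where
  "side s = bd (fst s) ! snd s"

definition nxt :: "'c \<times> nat \<Rightarrow> 'c \<times> nat" where
  "nxt s = (fst s, Suc (snd s) mod length (bd (fst s)))"

definition vert :: "'c \<times> nat \<Rightarrow> 'v" where
  "vert s = head T (side s)"

definition ends :: "'c \<times> nat \<Rightarrow> 'a set" where
  "ends s = {rv (side s), side (nxt s)}"

definition deg :: "'v \<Rightarrow> nat" where
  "deg v = card (out_arcs T v)"

definition corners_at :: "'v \<Rightarrow> ('c \<times> nat) set" where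
  "corners_at v = {s \<in> corners. vert s = v}"

lemma finite_corners [simp]: "finite corners"
proof -
  have "corners = Sigma F (\<lambda>c. {..<length (bd c)})" by (auto simp: corners_def)
  then show ?thesis using finite_F by simp
qed

lemma finite_corners_at [simp]: "finite (corners_at v)"
  by (simp add: corners_at_def)

lemma finite_out_arcs_T [simp]: "finite (out_arcs T v)"
  using finite_T by (simp add: out_arcs_def)

lemma side_arc [simp]: "s \<in> corners \<Longrightarrow> side s \<in> arcs T"
  using bd_arcs by (fastforce simp: corners_def side_def)

lemma nxt_corner [simp]: "s \<in> corners \<Longrightarrow> nxt s \<in> corners"
  by (auto simp: corners_def nxt_def bd_nonempty)

lemma nxt_inj: "inj_on nxt corners"
proof (rule inj_onI)
  fix s s' assume *: "s \<in> corners" "s' \<in> corners" "nxt s = nxt s'"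
  then show "s = s'"
    by (cases s; cases s') (auto simp: corners_def nxt_def mod_Suc split: if_splits)
qed

lemma nxt_surj: "nxt ` corners = corners"
  by (rule endo_inj_surj) (auto intro: nxt_inj)

lemma tail_side_nxt: "s \<in> corners \<Longrightarrow> tail T (side (nxt s)) = vert s"
  using bd_closed by (auto simp: corners_def side_def nxt_def vert_def)

lemma ends_out_arcs: "s \<in> corners \<Longrightarrow> ends s \<subseteq> out_arcs T (vert s)"
  using tail_side_nxt[of s] by (auto simp: ends_def vert_def arev_in_arcs)

lemma vert_in_verts: "s \<in> corners \<Longrightarrow> vert s \<in> verts T"
  by (simp add: vert_def)

lemma lt_side: "(c, q) \<in> corners \<Longrightarrow> lt (side (c, q)) = relator P (cell_rel c) ! q"
  using reads[of c] by (auto simp: corners_def side_def simp flip: nth_map)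

lemma length_bd: "c \<in> F \<Longrightarrow> length (bd c) = length (relator P (cell_rel c))"
  by (metis length_map reads)

text \<open>Since relators are cyclically reduced, the link has no loops.\<close>

lemma lt_ends:
  assumes "s \<in> corners"
  shows "lt (rv (side s)) \<noteq> lt (side (nxt s))"
proof -
  obtain c q where s: "s = (c, q)" by (cases s)
  then have c: "c \<in> F" "q < length (relator P (cell_rel c))" using assms length_bd by (auto simp: corners_def)
  have "relator P (cell_rel c) ! (Suc q mod length (relator P (cell_rel c))) \<noteq>
      inv_letter (relator P (cell_rel c) ! q)"
    using relators_reduced[OF cell_rel] c by (auto simp: cyclically_reduced_def)
  moreover have "lt (side (nxt s)) = relator P (cell_rel c) ! (Suc q mod length (relator P (cell_rel c)))"
    using lt_side nxt_corner[OF assms] length_bd[OF c(1)] by (simp add: s nxt_def)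
  ultimately show ?thesis
    using lt_rv lt_side assms s by auto
qed

lemma ends_neq: "s \<in> corners \<Longrightarrow> rv (side s) \<noteq> side (nxt s)"
  using lt_ends by metis

lemma card_ends: "s \<in> corners \<Longrightarrow> card (ends s) = 2"
  using ends_neq by (simp add: ends_def)

text \<open>The corners having \<open>a\<close> as an end correspond to the sides that run along the edge of \<open>a\<close>: the
  corner before a side equal to \<open>a\<close>, and the corner after a side equal to the reverse of \<open>a\<close>. So the
  links are 2-regular.\<close>

lemma two_corners:
  assumes a: "a \<in> arcs T"
  shows "card {s \<in> corners. a \<in> ends s} = 2"
proof -
  let ?A = "{s \<in> corners. side s = rv a}" and ?B = "{s \<in> corners. side s = a}"
  have pre: "nxt ` {s \<in> corners. side (nxt s) = a} = ?B"
  proof -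
    have "t \<in> nxt ` {s \<in> corners. side (nxt s) = a}" if "t \<in> ?B" for t
    proof -
      have "t \<in> nxt ` corners" using that nxt_surj by simp
      then show ?thesis using that by auto
    qed
    then show ?thesis by auto
  qed
  have inj: "inj_on nxt {s \<in> corners. side (nxt s) = a}"
    using nxt_inj by (rule inj_on_subset) auto
  have cB: "card {s \<in> corners. side (nxt s) = a} = card ?B"
    using card_image[OF inj] unfolding pre by (rule sym)
  have eq: "{s \<in> corners. a \<in> ends s} = ?A \<union> {s \<in> corners. side (nxt s) = a}"
  proof -
    have "a = rv (side s) \<longleftrightarrow> side s = rv a" for s by (metis arev_arev)
    then show ?thesis unfolding ends_def by blast
  qed
  have dj: "?A \<inter> {s \<in> corners. side (nxt s) = a} = {}"
  proof -
    have "side (nxt s) \<noteq> a" if "s \<in> corners" "side s = rv a" for s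
      using ends_neq[OF that(1)] that(2) by simp
    then show ?thesis by blast
  qed
  have "card {s \<in> corners. a \<in> ends s} = card ?A + card ?B"
    unfolding eq by (subst card_Un_disjoint) (use dj cB in auto)
  also have "\<dots> = card (?A \<union> ?B)"
    by (rule card_Un_disjoint[symmetric]) (use arev_neq[OF a] in auto)
  also have "?A \<union> ?B = {(c, q). c \<in> F \<and> q < length (bd c) \<and> bd c ! q \<in> {a, rv a}}"
    by (auto simp: corners_def side_def)
  finally show ?thesis using two_sides[OF a] by simp
qed

text \<open>A loopless 2-regular graph has as many edges as vertices.\<close>

lemma card_corners_at: "card (corners_at v) = deg v"
proof -
  have "(\<Sum>s \<in> corners_at v. card {a \<in> out_arcs T v. a \<in> ends s}) = 2 * card (out_arcs T v)"
  proof (rule sum_multicount)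
    show "\<forall>a \<in> out_arcs T v. card {s \<in> corners_at v. a \<in> ends s} = 2"
    proof
      fix a assume a: "a \<in> out_arcs T v"
      have "{s \<in> corners_at v. a \<in> ends s} = {s \<in> corners. a \<in> ends s}"
        using ends_out_arcs a by (fastforce simp: corners_at_def)
      then show "card {s \<in> corners_at v. a \<in> ends s} = 2" using two_corners a by simp
    qed
  qed auto
  moreover have "card {a \<in> out_arcs T v. a \<in> ends s} = 2" if "s \<in> corners_at v" for s
  proof -
    have "{a \<in> out_arcs T v. a \<in> ends s} = ends s"
      using ends_out_arcs[of s] that by (auto simp: corners_at_def)
    then show ?thesis using card_ends that by (simp add: corners_at_def)
  qed
  ultimately show ?thesis by (simp add: deg_def)
qed

lemma deg_ge_2: "s \<in> corners \<Longrightarrow> deg (vert s) \<ge> 2"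
  using card_mono[OF finite_out_arcs_T ends_out_arcs[of s]] card_ends[of s] by (simp add: deg_def)

lemma deg_2_other_corner:
  assumes s: "s \<in> corners" and d: "deg (vert s) = 2"
  obtains s' where "s' \<in> corners" "s' \<noteq> s" "vert s' = vert s" "ends s' = ends s"
proof -
  have "card (corners_at (vert s)) = 2" using card_corners_at d by simp
  moreover have "s \<in> corners_at (vert s)" using s by (simp add: corners_at_def)
  ultimately obtain s' where "corners_at (vert s) = {s, s'}" "s' \<noteq> s"
    by (rule card_2_other)
  then have s': "s' \<in> corners_at (vert s)" "s' \<noteq> s" by auto
  have "ends t = out_arcs T (vert s)" if "t \<in> corners_at (vert s)" for t
    using that ends_out_arcs[of t] card_ends[of t] d
    by (intro card_subset_eq) (simp_all add: corners_at_def deg_def)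
  then have "ends s' = ends s" using s s' by (simp add: corners_at_def)
  then show ?thesis using that[of s'] s' by (simp add: corners_at_def)
qed

lemma ends_eq_cases:
  assumes "s \<in> corners" "s' \<in> corners" "ends s' = ends s"
  obtains (same) "side s' = side s" "side (nxt s') = side (nxt s)"
    | (opposite) "side s' = rv (side (nxt s))" "side (nxt s') = rv (side s)"
proof -
  have "rv (side s') = rv (side s) \<and> side (nxt s') = side (nxt s) \<or>
      rv (side s') = side (nxt s) \<and> side (nxt s') = rv (side s)"
    using assms ends_neq by (auto simp: ends_def doubleton_eq_iff)
  then show ?thesis using that by (metis arev_arev)
qed

text \<open>The two corners at a vertex of degree 2 have the same ends, hence read the same word up to
  inversion. If they read it at the same place of the same relator, the two cells would be mirror
  images across a common edge.\<close>

lemma deg_2_imp_piece: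
  assumes s: "(c, q) \<in> corners" and d: "deg (vert (c, q)) = 2"
  shows "piece P [relator P (cell_rel c) ! q,
    relator P (cell_rel c) ! (Suc q mod length (relator P (cell_rel c)))]"
proof -
  obtain s' where s': "s' \<in> corners" "s' \<noteq> (c, q)" "ends s' = ends (c, q)"
    using deg_2_other_corner[OF s d] by metis
  obtain c' q' where cq: "s' = (c', q')" by (cases s')
  have c: "c \<in> F" "q < length (bd c)" and c': "c' \<in> F" "q' < length (bd c')"
    using s s' cq by (auto simp: corners_def)
  let ?r = "relator P (cell_rel c)" and ?r' = "relator P (cell_rel c')"
  let ?a = "?r ! q" and ?b = "?r ! (Suc q mod length ?r)"
  have la: "lt (side (c, q)) = ?a" and la': "lt (side s') = ?r' ! q'"
    using lt_side s s'(1) cq by auto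
  have lb: "lt (side (nxt (c, q))) = ?b" and lb': "lt (side (nxt s')) = ?r' ! (Suc q' mod length ?r')"
    using lt_side nxt_corner[OF s] nxt_corner[OF s'(1)] c c' length_bd by (auto simp: nxt_def cq)
  have o1: "(cell_rel c, q) \<in> occurrences P [?a, ?b]"
    using c cell_rel length_bd by (simp add: occurrences_pair)
  have rel: "cell_rel c' \<in> rels P" "q' < length ?r'" using c' cell_rel length_bd by auto
  from s s'(1,3) have o2: "(cell_rel c', q') \<in> occurrences P [?a, ?b]"
  proof (cases rule: ends_eq_cases)
    case same
    then show ?thesis using la la' lb lb' rel by (simp add: occurrences_pair)
  next
    case opposite
    then have "?r' ! q' = inv_letter ?b" "?r' ! (Suc q' mod length ?r') = inv_letter ?a"
      using la la' lb lb' lt_rv s nxt_corner[OF s] side_arc by auto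
    then show ?thesis using rel by (simp add: occurrences_pair)
  qed
  have "(cell_rel c, q) \<noteq> (cell_rel c', q')"
  proof
    assume "(cell_rel c, q) = (cell_rel c', q')"
    then have e: "cell_rel c = cell_rel c'" "q' = q" by auto
    from s s'(1,3) show False
    proof (cases rule: ends_eq_cases)
      case same
      then have "bd c' ! q = bd c ! q" by (simp add: cq side_def e)
      then have "c = c'" using no_fold[of c c' q] c c' e by auto
      then show False using s'(2) cq e by simp
    next
      case opposite
      then have "lt (side s') = inv_letter (lt (side (nxt (c, q))))"
        using s nxt_corner[OF s] lt_rv side_arc by simp
      then have "?b = inv_letter ?a" using la' lb e by auto
      moreover have "?b \<noteq> inv_letter ?a"
        using lt_ends[OF s] la lb lt_rv s by auto
      ultimately show False by simp
    qed
  qed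
  then show ?thesis unfolding piece_def using o1 o2 by blast
qed

lemma card_edge_sides:
  assumes "a \<in> arcs T"
  shows "card {s \<in> corners. side s \<in> {a, rv a}} = 2"
proof -
  have "{s \<in> corners. side s \<in> {a, rv a}} =
      {(c, q). c \<in> F \<and> q < length (bd c) \<and> bd c ! q \<in> {a, rv a}}"
    by (auto simp: corners_def side_def)
  then show ?thesis using two_sides[OF assms] by simp
qed

definition opp :: "'c \<times> nat \<Rightarrow> 'c \<times> nat" where
  "opp s = (THE s'. s' \<in> corners \<and> s' \<noteq> s \<and> side s' \<in> {side s, rv (side s)})"

lemma ex1_opp:
  assumes s: "s \<in> corners"
  shows "\<exists>!s'. s' \<in> corners \<and> s' \<noteq> s \<and> side s' \<in> {side s, rv (side s)}"
proof -
  let ?E = "{s' \<in> corners. side s' \<in> {side s, rv (side s)}}"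
  have "card ?E = 2" using card_edge_sides[of "side s"] s by simp
  moreover have "s \<in> ?E" using s by simp
  ultimately obtain s' where "?E = {s, s'}" "s' \<noteq> s"
    by (rule card_2_other)
  then show ?thesis by blast
qed

lemma opp:
  assumes "s \<in> corners"
  shows "opp s \<in> corners" "opp s \<noteq> s" "side (opp s) = side s \<or> side (opp s) = rv (side s)"
  using theI'[OF ex1_opp[OF assms]] unfolding opp_def by auto

lemma opp_eqI:
  assumes "s \<in> corners" "s' \<in> corners" "s' \<noteq> s" "side s' = side s \<or> side s' = rv (side s)"
  shows "opp s = s'"
  unfolding opp_def using ex1_opp[OF assms(1)] assms(2-) by (intro the1_equality) auto

text \<open>At a vertex of degree 2 the cell on the other side of the edge path continues along both edges,
  in the same or in the opposite direction.\<close>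

lemma deg_2_opp:
  assumes s: "s \<in> corners" and d: "deg (vert s) = 2"
  obtains (same) "opp (nxt s) = nxt (opp s)" "side (opp s) = side s"
      "side (opp (nxt s)) = side (nxt s)" "vert (opp s) = vert s"
    | (opposite) "opp s = nxt (opp (nxt s))" "side (opp s) = rv (side s)"
      "side (opp (nxt s)) = rv (side (nxt s))" "vert (opp (nxt s)) = vert s"
proof -
  obtain s' where s': "s' \<in> corners" "s' \<noteq> s" "vert s' = vert s" "ends s' = ends s"
    using deg_2_other_corner[OF s d] by metis
  have n: "nxt s \<in> corners" "nxt s' \<in> corners" using s s' by auto
  from s s'(1,4) show ?thesis
  proof (cases rule: ends_eq_cases)
    case same
    have "nxt s' \<noteq> nxt s" using s s' nxt_inj by (auto dest: inj_onD)
    then have "opp s = s'" "opp (nxt s) = nxt s'"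
      using same s s' n by (auto intro!: opp_eqI)
    then show ?thesis using that(1) same s'(3) by simp
  next
    case opposite
    have "nxt s' \<noteq> s" using opposite arev_neq[of "side s"] s by auto
    moreover have "s' \<noteq> nxt s" using opposite arev_neq[of "side (nxt s)"] n by auto
    ultimately have "opp s = nxt s'" "opp (nxt s) = s'"
      using opposite s s' n by (auto intro!: opp_eqI)
    then show ?thesis using that(2) opposite s'(3) by simp
  qed
qed

text \<open>The link of a vertex of degree 3 is a triangle, so two of its edges determine the third.\<close>

lemma third_corner:
  assumes d: "deg v = 3" and s: "s1 \<in> corners_at v" "s2 \<in> corners_at v" "s1 \<noteq> s2"
    and e: "ends s1 = {t, a}" "ends s2 = {t, b}" "a \<noteq> b"
  obtains s3 where "corners_at v = {s1, s2, s3}" "s3 \<noteq> s1" "s3 \<noteq> s2" "ends s3 = {a, b}"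
proof -
  have c: "s1 \<in> corners" "s2 \<in> corners" and v: "vert s1 = v" "vert s2 = v"
    using s by (auto simp: corners_at_def)
  have "card (corners_at v - {s1, s2}) = 1"
    using card_corners_at[of v] d s by (simp add: card_Diff_subset)
  then obtain s3 where s3: "corners_at v - {s1, s2} = {s3}" by (auto simp: card_1_singleton_iff)
  then have c3: "s3 \<in> corners" "vert s3 = v" "s3 \<noteq> s1" "s3 \<noteq> s2" by (auto simp: corners_at_def)
  have ta: "t \<noteq> a" "t \<noteq> b"
    using card_ends[OF c(1)] card_ends[OF c(2)] unfolding e by (cases "t = a"; cases "t = b"; simp)+
  have sub: "{t, a, b} \<subseteq> out_arcs T v"
    using ends_out_arcs[OF c(1)] ends_out_arcs[OF c(2)] unfolding v e by simp
  have out: "out_arcs T v = {t, a, b}"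
    using card_subset_eq[OF finite_out_arcs_T sub] d ta e(3) by (simp add: deg_def)
  have "t \<notin> ends s3"
  proof
    assume "t \<in> ends s3"
    then have "{s1, s2, s3} \<subseteq> {s \<in> corners. t \<in> ends s}" using c c3 e by auto
    then have "card {s1, s2, s3} \<le> card {s \<in> corners. t \<in> ends s}"
      by (intro card_mono) auto
    also have "\<dots> = 2" using two_corners sub by auto
    finally show False using c3 s(3) by auto
  qed
  then have "ends s3 \<subseteq> {a, b}" using ends_out_arcs[OF c3(1)] out c3 by auto
  moreover have "card (ends s3) = card {a, b}" using card_ends[OF c3(1)] e(3) by simp
  ultimately have "ends s3 = {a, b}" by (intro card_subset_eq) auto
  moreover have "corners_at v = {s1, s2, s3}" using s3 s by auto
  ultimately show ?thesis using that c3 by auto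
qed

lemma sum_deg: "(\<Sum>v \<in> verts T. deg v) = card (arcs T)"
proof -
  have "(\<Sum>v \<in> verts T. card (out_arcs T v)) = card (\<Union>v \<in> verts T. out_arcs T v)"
    using finite_T by (subst card_UN_disjoint) auto
  also have "(\<Union>v \<in> verts T. out_arcs T v) = arcs T" by auto
  finally show ?thesis by (simp add: deg_def)
qed

text \<open>Weights are exterior angles in units of \<open>\<pi>/k\<close>. The sum of all weights is at least \<open>2 k\<close> per 2-cell, and it
  falls short of \<open>k\<close> times the number of corners by at least \<open>2 k\<close> per vertex. There are as many
  corners as arcs, i.e. two for each geometric edge.\<close>

lemma combinatorial_gauss_bonnet:
  fixes wt :: "'c \<times> nat \<Rightarrow> nat"
  assumes vertex: "\<And>v. v \<in> verts T \<Longrightarrow> sum wt (corners_at v) + 2 * k \<le> k * deg v"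
    and cell: "\<And>c. c \<in> F \<Longrightarrow> 2 * k \<le> (\<Sum>q < length (bd c). wt (c, q))"
  shows "k * (2 * card (verts T) + 2 * card F) \<le> k * card (arcs T)"
proof -
  have "2 * k * card F = (\<Sum>c \<in> F. 2 * k)" by simp
  also have "\<dots> \<le> (\<Sum>c \<in> F. \<Sum>q < length (bd c). wt (c, q))"
    using cell by (rule sum_mono)
  also have "\<dots> = sum wt (Sigma F (\<lambda>c. {..<length (bd c)}))"
    using sum.Sigma[OF finite_F, of "\<lambda>c. {..<length (bd c)}" "\<lambda>c q. wt (c, q)"] by simp
  also have "Sigma F (\<lambda>c. {..<length (bd c)}) = corners" by (auto simp: corners_def)
  also have "sum wt corners = (\<Sum>v \<in> verts T. sum wt {s \<in> corners. vert s = v})"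
    by (rule sum.group[symmetric]) (use finite_T vert_in_verts in auto)
  also have "\<dots> = (\<Sum>v \<in> verts T. sum wt (corners_at v))" by (simp add: corners_at_def)
  finally have "2 * k * card F + (\<Sum>v \<in> verts T. 2 * k) \<le>
      (\<Sum>v \<in> verts T. sum wt (corners_at v) + 2 * k)"
    by (simp add: sum.distrib)
  also have "\<dots> \<le> (\<Sum>v \<in> verts T. k * deg v)" using vertex by (rule sum_mono)
  also have "\<dots> = k * card (arcs T)" by (simp add: sum_deg flip: sum_distrib_left)
  finally show ?thesis by (simp add: algebra_simps)
qed

end

section \<open>Full blocks\<close>

locale wlog_diagram =
  wlog_conditions G + labelled_diagram T rv "wlog_presentation G" F bd lt cell_rel
  for G :: "('x, 'e) word_labeled_graph"
    and T :: "('v, 'a) pre_digraph" and rv :: "'a \<Rightarrow> 'a"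
    and F :: "'c set" and bd :: "'c \<Rightarrow> 'a list"
    and lt :: "'a \<Rightarrow> 'x letter" and cell_rel :: "'c \<Rightarrow> 'e"
begin

abbreviation hf :: "'c \<Rightarrow> nat" where
  "hf c \<equiv> half (cell_rel c)"

definition special_corner :: "'c \<times> nat \<Rightarrow> bool" where
  "special_corner s \<longleftrightarrow> special (cell_rel (fst s)) (snd s)"

text \<open>The corners of block \<open>j\<close> are those at the positions \<open>j * hf c + m\<close> with \<open>m < hf c\<close>. The first and the
  last one are special, the others are the inner ones.\<close>

definition full_block :: "'c \<Rightarrow> nat \<Rightarrow> bool" where
  "full_block c j \<longleftrightarrow> (\<forall>m. 0 < m \<longrightarrow> Suc m < hf c \<longrightarrow> deg (vert (c, j * hf c + m)) = 2)"

definition full_corner :: "'c \<times> nat \<Rightarrow> bool" where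
  "full_corner s \<longleftrightarrow> special_corner s \<and> full_block (fst s) (snd s div hf (fst s))"

definition rung :: "'a \<Rightarrow> bool" where
  "rung a \<longleftrightarrow> (\<exists>(c, q) \<in> corners. q mod hf c = 0 \<and> side (c, q) \<in> {a, rv a})"

text \<open>The exterior angle in units of \<open>\<pi>/6\<close>.\<close>

definition weight :: "'c \<times> nat \<Rightarrow> nat" where
  "weight s = (if special_corner s then if full_corner s then 3 else 2
     else if deg (vert s) = 2 \<or> deg (vert s) = 3 \<and> (\<exists>s' \<in> corners_at (vert s). full_corner s') then 0
     else 2)"

lemma cell_rel_I [simp]: "c \<in> F \<Longrightarrow> cell_rel c \<in> I"
  using cell_rel by simp

lemma length_bd_half [simp]: "c \<in> F \<Longrightarrow> length (bd c) = 2 * hf c"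
  using length_bd by simp

lemma corner_iff: "(c, q) \<in> corners \<longleftrightarrow> c \<in> F \<and> q < 2 * hf c"
  by (auto simp: corners_def)

lemma hf_ge: "c \<in> F \<Longrightarrow> hf c \<ge> 3"
  by (simp add: half_ge)

lemma nxt_eq: "c \<in> F \<Longrightarrow> nxt (c, q) = (c, Suc q mod (2 * hf c))"
  by (simp add: nxt_def)

lemma lt_side_R: "(c, q) \<in> corners \<Longrightarrow> lt (side (c, q)) = R (cell_rel c) ! q"
  using lt_side by simp

lemma rung_rv: "rung (rv a) \<longleftrightarrow> rung a"
proof -
  have "{rv a, rv (rv a)} = {a, rv a}" by auto
  then show ?thesis by (simp only: rung_def)
qed

lemma special_corner_deg:
  assumes s: "s \<in> corners" and "special_corner s"
  shows "deg (vert s) \<ge> 3"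
proof -
  obtain c q where cq: "s = (c, q)" by (cases s)
  have c: "c \<in> F" "q < 2 * hf c" using s cq corner_iff by auto
  have "\<not> piece (wlog_presentation G) [R (cell_rel c) ! q, R (cell_rel c) ! (Suc q mod (2 * hf c))]"
    using special_not_piece assms(2) c by (simp add: special_corner_def cq)
  then have "deg (vert s) \<noteq> 2" using deg_2_imp_piece[of c q] s cq by auto
  then show ?thesis using deg_ge_2[OF s] by simp
qed

lemma rung_deg:
  assumes "rung a"
  shows "deg (tail T a) \<ge> 3" "deg (head T a) \<ge> 3"
proof -
  obtain c q where s: "(c, q) \<in> corners" "q mod hf c = 0" "side (c, q) \<in> {a, rv a}"
    using assms by (auto simp: rung_def)
  then obtain p where p: "p \<in> corners" "nxt p = (c, q)"
    using nxt_surj by (metis imageE)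
  obtain q' where q': "p = (c, q')" "c \<in> F" "Suc q' mod (2 * hf c) = q"
    using p by (cases p) (auto simp: nxt_def corner_iff)
  have "Suc q' mod hf c = 0" using q'(3) s(2) by (metis mod_mod_cancel dvd_triv_right)
  then have "special_corner p" "special_corner (c, q)" using s by (auto simp: special_corner_def special_def q')
  then have "deg (vert p) \<ge> 3" "deg (vert (c, q)) \<ge> 3" using special_corner_deg p s by auto
  then have d: "deg (tail T (side (c, q))) \<ge> 3" "deg (head T (side (c, q))) \<ge> 3"
    using tail_side_nxt[OF p(1)] p(2) by (auto simp: vert_def)
  have "a = side (c, q) \<or> a = rv (side (c, q))" using s(3) by auto
  then show "deg (tail T a) \<ge> 3" "deg (head T a) \<ge> 3" using d side_arc[OF s(1)] by auto
qed

text \<open>Along a path through vertices of degree 2 the neighbouring cell stays the same. Special corners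
  have degree at least 3, so the path does not turn around a special corner of that cell; in
  particular its positions there do not wrap around the end of the relator. This lemma is for a neighbour
  that runs in the same direction, the next one for a neighbour that runs backwards.\<close>

lemma run_same:
  assumes c: "c \<in> F" "q + K < 2 * hf c"
    and d: "\<forall>k<K. deg (vert (c, q + k)) = 2"
    and o: "opp (c, q) = (c1, q1)" "side (c1, q1) = side (c, q)"
    and k: "k \<le> K"
  shows "(c1, q1 + k) \<in> corners" "opp (c, q + k) = (c1, q1 + k)"
    "side (c1, q1 + k) = side (c, q + k)" "k < K \<Longrightarrow> \<not> special (cell_rel c1) (q1 + k)"
proof -
  have "(c1, q1 + k) \<in> corners \<and> opp (c, q + k) = (c1, q1 + k) \<and>
    side (c1, q1 + k) = side (c, q + k) \<and> (k < K \<longrightarrow> \<not> special (cell_rel c1) (q1 + k))"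
    using k
  proof (induction k)
    case 0
    have s: "(c, q) \<in> corners" using c by (simp add: corner_iff)
    have n: "(c1, q1) \<in> corners" using opp(1)[OF s] o by simp
    have "\<not> special (cell_rel c1) q1" if "0 < K"
    proof -
      have "deg (vert (c1, q1)) = 2" using d[rule_format, OF that] o(2) by (simp add: vert_def)
      then show ?thesis using special_corner_deg[OF n] by (auto simp: special_corner_def)
    qed
    then show ?case using n o by simp
  next
    case (Suc k)
    let ?s = "(c, q + k)"
    have s: "?s \<in> corners" using c Suc.prems by (simp add: corner_iff)
    have nx: "nxt ?s = (c, q + Suc k)" using c Suc.prems by (simp add: nxt_eq)
    have IH: "(c1, q1 + k) \<in> corners" "opp ?s = (c1, q1 + k)" "side (c1, q1 + k) = side ?s"
      "\<not> special (cell_rel c1) (q1 + k)" using Suc by auto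
    have c1: "c1 \<in> F" "q1 + k < 2 * hf c1" using IH(1) by (auto simp: corner_iff)
    have nx1: "nxt (c1, q1 + k) = (c1, q1 + Suc k)"
      using not_special_Suc_less[OF IH(4) c1(2)] c1 by (simp add: nxt_eq)
    have dk: "deg (vert ?s) = 2" using d Suc.prems by simp
    from s dk have n: "opp (nxt ?s) = nxt (opp ?s) \<and> side (opp (nxt ?s)) = side (nxt ?s)"
    proof (cases rule: deg_2_opp)
      case opposite
      then show ?thesis using IH arev_neq[of "side ?s"] s by simp
    qed simp
    then have e: "opp (c, q + Suc k) = (c1, q1 + Suc k)" "side (c1, q1 + Suc k) = side (c, q + Suc k)"
      using nx nx1 IH(2) by auto
    have cc: "(c1, q1 + Suc k) \<in> corners" using nxt_corner[OF IH(1)] nx1 by simp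
    have "\<not> special (cell_rel c1) (q1 + Suc k)" if "Suc k < K"
    proof -
      have "deg (vert (c1, q1 + Suc k)) = 2" using d[rule_format, OF that] e(2) by (simp add: vert_def)
      then show ?thesis using special_corner_deg[OF cc] by (auto simp: special_corner_def)
    qed
    then show ?case using e cc by simp
  qed
  then show "(c1, q1 + k) \<in> corners" "opp (c, q + k) = (c1, q1 + k)"
    "side (c1, q1 + k) = side (c, q + k)" "k < K \<Longrightarrow> \<not> special (cell_rel c1) (q1 + k)"
    by auto
qed

lemma run_opposite:
  assumes c: "c \<in> F" "q + K < 2 * hf c"
    and d: "\<forall>k<K. deg (vert (c, q + k)) = 2"
    and o: "opp (c, q) = (c1, q1)" "side (c1, q1) = rv (side (c, q))"
    and k: "k \<le> K"
  shows "k \<le> q1" "(c1, q1 - k) \<in> corners" "opp (c, q + k) = (c1, q1 - k)"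
    "side (c1, q1 - k) = rv (side (c, q + k))" "0 < k \<Longrightarrow> \<not> special (cell_rel c1) (q1 - k)"
proof -
  have "k \<le> q1 \<and> (c1, q1 - k) \<in> corners \<and> opp (c, q + k) = (c1, q1 - k) \<and>
    side (c1, q1 - k) = rv (side (c, q + k)) \<and> (0 < k \<longrightarrow> \<not> special (cell_rel c1) (q1 - k))"
    using k
  proof (induction k)
    case 0
    have s: "(c, q) \<in> corners" using c by (simp add: corner_iff)
    have n: "(c1, q1) \<in> corners" using opp(1)[OF s] o by simp
    then show ?case using o by simp
  next
    case (Suc k)
    let ?s = "(c, q + k)"
    have s: "?s \<in> corners" using c Suc.prems by (simp add: corner_iff)
    have nx: "nxt ?s = (c, q + Suc k)" using c Suc.prems by (simp add: nxt_eq)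
    have IH: "k \<le> q1" "(c1, q1 - k) \<in> corners" "opp ?s = (c1, q1 - k)"
      "side (c1, q1 - k) = rv (side ?s)" using Suc by auto
    have dk: "deg (vert ?s) = 2" using d Suc.prems by simp
    from s dk have n: "opp ?s = nxt (opp (nxt ?s)) \<and> side (opp (nxt ?s)) = rv (side (nxt ?s)) \<and>
      vert (opp (nxt ?s)) = vert ?s"
    proof (cases rule: deg_2_opp)
      case same
      then show ?thesis using IH arev_neq[of "side ?s"] s by simp
    qed simp
    obtain c2 q2 where o2: "opp (nxt ?s) = (c2, q2)" by (cases "opp (nxt ?s)")
    have cc: "(c2, q2) \<in> corners" using opp(1)[OF nxt_corner[OF s]] o2 by simp
    have "deg (vert (c2, q2)) = 2" using n o2 dk by simp
    then have ns: "\<not> special (cell_rel c2) q2" using special_corner_deg[OF cc] by (auto simp: special_corner_def)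
    have "nxt (c2, q2) = (c2, Suc q2)"
      using not_special_Suc_less[OF ns] cc by (simp add: nxt_eq corner_iff)
    then have "c2 = c1" "Suc q2 = q1 - k" using n IH o2 by auto
    then have "c2 = c1" "Suc k \<le> q1" "q2 = q1 - Suc k" by auto
    then show ?case using n cc ns o2 nx by simp
  qed
  then show "k \<le> q1" "(c1, q1 - k) \<in> corners" "opp (c, q + k) = (c1, q1 - k)"
    "side (c1, q1 - k) = rv (side (c, q + k))" "0 < k \<Longrightarrow> \<not> special (cell_rel c1) (q1 - k)"
    by auto
qed

text \<open>The neighbour \<open>c1\<close> along a full block reads the whole block word, or its inverse, inside one
  of its own blocks. By injectivity it has the same relator, and then the two blocks have equal
  length and coincide. The same direction is impossible: either the cells fold onto each other or the label
  equals its inverse. In the opposite direction the words are inverse to each other, so \<open>c1\<close>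
  is glued along its other block, again because the label differs from its inverse.\<close>

lemma full_block_partner:
  assumes c: "c \<in> F" and j: "j < 2" and fb: "full_block c j"
  obtains c' where "c' \<in> F" "cell_rel c' = cell_rel c"
    "\<And>m. 0 < m \<Longrightarrow> m < hf c \<Longrightarrow> side (c', (1 - j) * hf c + (hf c - m)) = rv (side (c, j * hf c + m))"
proof -
  let ?i = "cell_rel c" and ?h = "hf c"
  define K where "K = ?h - 2"
  let ?q = "j * ?h + 1"
  have h: "?h \<ge> 3" using hf_ge[OF c] .
  have K: "0 < K" "?h = K + 2" using h by (auto simp: K_def)
  have jj: "j = 0 \<or> j = 1" using j by auto
  have qK: "?q + K < 2 * ?h" using jj K(2) by auto
  have "deg (vert (c, ?q + k)) = 2" if "k < K" for k
    using fb[unfolded full_block_def, rule_format, of "Suc k"] that K(2) by simp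
  then have d: "\<forall>k<K. deg (vert (c, ?q + k)) = 2" by blast
  have s: "(c, ?q) \<in> corners" using c qK by (simp add: corner_iff)
  obtain c1 q1 where o: "opp (c, ?q) = (c1, q1)" by (cases "opp (c, ?q)")
  have s1: "(c1, q1) \<in> corners" using opp(1)[OF s] o by simp
  let ?i1 = "cell_rel c1"
  have c1: "c1 \<in> F" "?i1 \<in> I" using s1 by (auto simp: corner_iff)
  have letter: "block ?i j ! k = lt (side (c, ?q + k))" if "k \<le> K" for k
    using R_block[OF j, of k ?i] lt_side_R[of c "?q + k"] c qK K(2) that by (simp add: corner_iff)
  have "side (c1, q1) = side (c, ?q) \<or> side (c1, q1) = rv (side (c, ?q))"
    using opp(3)[OF s] o by simp
  then show ?thesis
  proof
    assume "side (c1, q1) = side (c, ?q)"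
    note run = run_same[OF c qK d o this]
    have "q1 + K < 2 * hf c1" using run(1)[of K] by (simp add: corner_iff)
    then obtain j1 off where j1: "j1 < 2" "Suc (off + K) < hf c1"
      "\<And>k. k \<le> K \<Longrightarrow> q1 + k = j1 * hf c1 + Suc (off + k)"
      using not_special_run[of K ?i1 q1] K(1) run(4) by auto
    have eq: "block ?i j ! k = block ?i1 j1 ! (off + k)" if "k \<le> K" for k
      using letter[OF that] run(1,3)[OF that] lt_side_R[of c1 "q1 + k"]
        j1(3)[OF that] R_block[OF j1(1), of "off + k" ?i1] j1(2) that by simp
    have "sublist (block ?i j) (block ?i1 j1)"
      using K j1(2) eq by (intro sublist_if_nth[of off]) auto
    then have i1: "?i1 = ?i" using block_sublist_imp_eq[of ?i ?i1 j j1] c c1 j j1 by simp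
    have off: "off = 0" using j1(2) K(2) i1 by simp
    have beq: "block ?i j = block ?i j1"
      using eq i1 off K(2) by (intro nth_equalityI) auto
    \<comment> \<open>The two blocks of a relator read different words.\<close>
    have "j1 = j"
      using beq block_neq_other[of ?i] c jj j1(1) by (auto simp: less_2_cases_iff)
    then have "q1 = ?q" using j1(3)[of 0] off i1 by simp
    then have "bd c1 ! ?q = bd c ! ?q" using \<open>side (c1, q1) = side (c, ?q)\<close> by (simp add: side_def)
    then have "c1 = c" using no_fold[OF c c1(1) i1[symmetric], of ?q] c qK by simp
    then show ?thesis using opp(2)[OF s] o \<open>q1 = ?q\<close> by simp
  next
    assume "side (c1, q1) = rv (side (c, ?q))"
    note run = run_opposite[OF c qK d o this]
    define b where "b = q1 - K"
    have q1: "q1 = b + K" using run(1)[of K] by (simp add: b_def)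
    have ns: "\<not> special ?i1 (b + k)" if "k < K" for k
      using run(5)[of "K - k"] that q1 by simp
    have "b + K < 2 * hf c1" using s1 q1 by (simp add: corner_iff)
    then obtain j1 off where j1: "j1 < 2" "Suc (off + K) < hf c1"
      "\<And>k. k \<le> K \<Longrightarrow> b + k = j1 * hf c1 + Suc (off + k)"
      using not_special_run[of K ?i1 b] K(1) ns by auto
    have eq: "inv_word (block ?i j) ! k = block ?i1 j1 ! (off + k)" if "k \<le> K" for k
    proof -
      have "inv_word (block ?i j) ! k = inv_letter (block ?i j ! (K - k))"
        using that K(2) by (simp add: nth_inv_word)
      also have "\<dots> = lt (rv (side (c, ?q + (K - k))))"
        using letter[of "K - k"] lt_rv side_arc c qK by (simp add: corner_iff)
      also have "\<dots> = lt (side (c1, b + k))"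
        using run(4)[of "K - k"] q1 that by simp
      also have "\<dots> = R ?i1 ! (b + k)"
        using run(2)[of "K - k"] q1 that lt_side_R[of c1 "b + k"] by simp
      also have "\<dots> = block ?i1 j1 ! (off + k)"
        unfolding j1(3)[OF that] by (rule R_block[OF j1(1)]) (use j1(2) that in simp)
      finally show ?thesis .
    qed
    have "sublist (inv_word (block ?i j)) (block ?i1 j1)"
      using K j1(2) eq by (intro sublist_if_nth[of off]) auto
    then have i1: "?i1 = ?i" using block_sublist_imp_eq[of ?i ?i1 j j1] c c1 j j1 by simp
    have off: "off = 0" using j1(2) K(2) i1 by simp
    have beq: "inv_word (block ?i j) = block ?i j1"
      using eq i1 off K(2) by (intro nth_equalityI) auto
    \<comment> \<open>As the two words are inverse to each other, here the blocks differ.\<close>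
    have jeq: "j1 = 1 - j"
      using beq block_neq_other[of ?i] c jj j1(1) inv_word_block[OF j, of ?i]
      by (auto simp: less_2_cases_iff)
    have "side (c1, (1 - j) * ?h + (?h - m)) = rv (side (c, j * ?h + m))" if "0 < m" "m < ?h" for m
    proof -
      have m: "m - 1 \<le> K" "?q + (m - 1) = j * ?h + m" using that K(2) by auto
      have "b = (1 - j) * ?h + 1" using j1(3)[of 0] off i1 jeq by simp
      then have "q1 - (m - 1) = (1 - j) * ?h + (?h - m)" using q1 that K(2) by simp
      then show ?thesis using run(4)[OF m(1)] m(2) by simp
    qed
    then show ?thesis using that c1 i1 by blast
  qed
qed

section \<open>Corner weights\<close>

lemma block_nxt:
  assumes "c \<in> F" "j < 2" "Suc m < hf c"
  shows "(c, j * hf c + m) \<in> corners" "nxt (c, j * hf c + m) = (c, j * hf c + Suc m)"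
proof -
  have "j * hf c + Suc m < 2 * hf c" using assms by (auto simp: less_2_cases_iff)
  then show "(c, j * hf c + m) \<in> corners" "nxt (c, j * hf c + m) = (c, j * hf c + Suc m)"
    using assms(1) by (auto simp: corner_iff nxt_eq)
qed

lemma block_end_nxt:
  assumes "c \<in> F" "j < 2"
  shows "(c, j * hf c + (hf c - 1)) \<in> corners"
    "nxt (c, j * hf c + (hf c - 1)) = (c, (1 - j) * hf c)"
  using assms half_pos[of "cell_rel c"]
  by (auto simp: corner_iff nxt_eq less_2_cases_iff simp del: half_pos simp flip: mult_2)

lemma block_end_div: "(j * hf c + (hf c - 1)) div hf c = j"
proof -
  have "hf c - 1 < hf c" by simp
  then show ?thesis by (simp only: div_mult_self3 half_pos div_less add_0_right neq0_conv)
qed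

lemma full_block_other:
  assumes c: "c \<in> F" and j: "j < 2" and fb: "full_block c j"
    and c': "c' \<in> F" "cell_rel c' = cell_rel c"
    and mirror: "\<And>m. 0 < m \<Longrightarrow> m < hf c \<Longrightarrow>
      side (c', (1 - j) * hf c + (hf c - m)) = rv (side (c, j * hf c + m))"
  shows "full_block c' (1 - j)"
  unfolding full_block_def
proof (intro allI impI)
  fix n assume n: "0 < n" "Suc n < hf c'"
  define m where "m = hf c - Suc n"
  have m: "0 < m" "Suc m < hf c" "n = hf c - Suc m" using n c' by (auto simp: m_def)
  have "side (c', (1 - j) * hf c' + n) = rv (side (c, j * hf c + Suc m))"
    using mirror[of "Suc m"] m c' by simp
  also have "side (c, j * hf c + Suc m) = side (nxt (c, j * hf c + m))"
    using block_nxt[OF c j m(2)] by simp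
  finally have "vert (c', (1 - j) * hf c' + n) = vert (c, j * hf c + m)"
    using tail_side_nxt[OF block_nxt(1)[OF c j m(2)]] side_arc nxt_corner block_nxt(1)[OF c j m(2)]
    by (simp add: vert_def)
  then show "deg (vert (c', (1 - j) * hf c' + n)) = 2"
    using fb m unfolding full_block_def by simp
qed

text \<open>The vertex of a special corner of a full block also carries a special corner of the partner cell. The
  two corners share the end \<open>t\<close> on the common block, and their other ends \<open>a\<close>, \<open>b\<close> are rungs in line: one
  is labelled with the letter of the rung, the other with its inverse.\<close>

lemma full_corner_partner:
  assumes s: "s \<in> corners" and full_corner: "full_corner s"
  obtains s' t a b where "s' \<in> corners" "full_corner s'" "vert s' = vert s"
    "ends s = {t, a}" "ends s' = {t, b}" "lt b = inv_letter (lt a)" "rung a" "rung b"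
proof -
  obtain c q where cq: "s = (c, q)" by (cases s)
  let ?h = "hf c"
  define j where "j = q div ?h"
  have c: "c \<in> F" "q < 2 * ?h" using s cq corner_iff by auto
  have h: "?h \<ge> 3" using hf_ge[OF c(1)] .
  have j: "j < 2" "1 - j < 2" using c(2) by (auto simp: j_def div_less_iff_less_mult)
  have jj: "1 - (1 - j) = j" using j by simp
  have fb: "full_block c j" using full_corner by (simp add: full_corner_def cq j_def)
  obtain c' where c': "c' \<in> F" "cell_rel c' = cell_rel c"
    and mirror: "\<And>m. 0 < m \<Longrightarrow> m < ?h \<Longrightarrow>
      side (c', (1 - j) * ?h + (?h - m)) = rv (side (c, j * ?h + m))"
    using full_block_partner[OF c(1) j(1) fb] by blast
  have fb': "full_block c' (1 - j)" using full_block_other[OF c(1) j(1) fb c' mirror] .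
  have q: "q = j * ?h + q mod ?h" unfolding j_def by (rule div_mult_mod_eq[symmetric])
  have "q mod ?h = 0 \<or> Suc q mod ?h = 0" using full_corner by (simp add: full_corner_def special_corner_def special_def cq)
  then show ?thesis
  proof
    assume "q mod ?h = 0"
    then have s_eq: "s = (c, j * ?h)" using q cq by simp
    have n: "nxt s = (c, j * ?h + 1)" using block_nxt[OF c(1) j(1), of 0] h s_eq by simp
    let ?s' = "(c', (1 - j) * ?h + (?h - 1))"
    have s': "?s' \<in> corners" "nxt ?s' = (c', j * ?h)"
      using block_end_nxt[OF c'(1) j(2)] c'(2) jj by auto
    have t: "side ?s' = rv (side (nxt s))" using mirror[of 1] h n by simp
    have "?s' \<in> corners" by (rule s')
    moreover have "full_corner ?s'"
    proof -
      have "Suc ((1 - j) * ?h + (?h - 1)) = (1 - j) * ?h + ?h" using h by simp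
      then have "special (cell_rel c) ((1 - j) * ?h + (?h - 1))"
        by (simp only: special_def mod_mult_self3 mod_self simp_thms)
      then show ?thesis
        using fb' c'(2) block_end_div[of "1 - j" c] by (simp only: full_corner_def special_corner_def fst_conv snd_conv)
    qed
    moreover have "vert ?s' = vert s"
      using t tail_side_nxt[OF s] side_arc[OF nxt_corner[OF s]] by (simp add: vert_def)
    moreover have "ends s = {side (nxt s), rv (side s)}" by (auto simp: ends_def)
    moreover have "ends ?s' = {side (nxt s), side (nxt ?s')}" using t by (simp add: ends_def)
    moreover have "lt (side (nxt ?s')) = inv_letter (lt (rv (side s)))"
      using lt_rv side_arc[OF s] lt_side_R[of c "j * ?h"] lt_side_R[of c' "j * ?h"]
        nxt_corner[OF s'(1)] s'(2) s s_eq c'(2) by simp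
    moreover have "rung (rv (side s))"
      unfolding rung_rv rung_def using s s_eq by (auto intro!: bexI[of _ s])
    moreover have "rung (side (nxt ?s'))"
      unfolding rung_def using nxt_corner[OF s'(1)] s'(2) c'(2) by (auto intro!: bexI[of _ "nxt ?s'"])
    ultimately show ?thesis by (rule that)
  next
    assume "Suc q mod ?h = 0"
    then have "q mod ?h = ?h - 1" using mod_Suc[of q ?h] by (auto split: if_splits)
    then have s_eq: "s = (c, j * ?h + (?h - 1))" using q cq by simp
    have n: "nxt s = (c, (1 - j) * ?h)" using block_end_nxt[OF c(1) j(1)] s_eq by simp
    let ?s' = "(c', (1 - j) * ?h)"
    have s': "?s' \<in> corners" "nxt ?s' = (c', (1 - j) * ?h + 1)"
      using block_nxt[OF c'(1) j(2), of 0] c'(2) h by auto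
    have t: "side (nxt ?s') = rv (side s)" using mirror[of "?h - 1"] h s'(2) s_eq by simp
    have "?s' \<in> corners" by (rule s')
    moreover have "full_corner ?s'"
      using fb' h c' by (simp add: full_corner_def special_corner_def special_def)
    moreover have "vert ?s' = vert s"
      using t tail_side_nxt[OF s'(1)] side_arc[OF s] by (simp add: vert_def)
    moreover have "ends s = {rv (side s), side (nxt s)}" by (simp add: ends_def)
    moreover have "ends ?s' = {rv (side s), rv (side ?s')}" using t by (auto simp: ends_def)
    moreover have "lt (rv (side ?s')) = inv_letter (lt (side (nxt s)))"
      using lt_rv side_arc[OF s'(1)] lt_side_R[of c "(1 - j) * ?h"] lt_side_R[of c' "(1 - j) * ?h"]
        nxt_corner[OF s] s' n c'(2) by simp
    moreover have "rung (side (nxt s))"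
      unfolding rung_def using nxt_corner[OF s] n by (auto intro!: bexI[of _ "nxt s"])
    moreover have "rung (rv (side ?s'))"
      unfolding rung_rv rung_def using s' c'(2) by (auto intro!: bexI[of _ ?s'])
    ultimately show ?thesis by (rule that)
  qed
qed

text \<open>If the vertex has degree 3, the third corner joins the two rungs. It passes from a letter to the same
  letter, so it is not special.\<close>

lemma full_at_degree_3:
  assumes d: "deg v = 3" and s: "s \<in> corners_at v" and full_corner: "full_corner s"
  obtains s' s3 where "corners_at v = {s, s', s3}" "s \<noteq> s'" "s3 \<noteq> s" "s3 \<noteq> s'" "full_corner s'" "\<not> special_corner s3"
    "lt (side (nxt s3)) = lt (side s3)" "deg (tail T (side s3)) \<ge> 3" "deg (vert (nxt s3)) \<ge> 3"
proof -
  have sc: "s \<in> corners" "vert s = v" using s by (auto simp: corners_at_def)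
  obtain s' t a b where *: "s' \<in> corners" "full_corner s'" "vert s' = vert s"
    "ends s = {t, a}" "ends s' = {t, b}" "lt b = inv_letter (lt a)" "rung a" "rung b"
    by (rule full_corner_partner[OF sc(1) full_corner])
  have ab: "a \<noteq> b" using *(6) inv_letter_neq by metis
  have "a \<noteq> t" "b \<noteq> t" using card_ends[OF sc(1)] card_ends[OF *(1)] *(4,5)
    by (cases "a = t"; cases "b = t"; simp)+
  then have ss': "s \<noteq> s'" using * ab by (auto simp: doubleton_eq_iff)
  have s': "s' \<in> corners_at v" using * sc by (simp add: corners_at_def)
  obtain s3 where s3: "corners_at v = {s, s', s3}" "s3 \<noteq> s" "s3 \<noteq> s'" "ends s3 = {a, b}"
    by (rule third_corner[OF d s s' ss' *(4,5) ab])
  have c3: "s3 \<in> corners" using s3(1) by (auto simp: corners_at_def)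
  have e: "rv (side s3) = a \<and> side (nxt s3) = b \<or> rv (side s3) = b \<and> side (nxt s3) = a"
    using s3(4) by (auto simp: ends_def doubleton_eq_iff)
  then have r: "rung (side s3)" "rung (side (nxt s3))" using * rung_rv by metis+
  have "lt (side (nxt s3)) = inv_letter (lt (rv (side s3)))"
    using e *(6) by auto
  then have l: "lt (side (nxt s3)) = lt (side s3)" using lt_rv side_arc[OF c3] by simp
  have "\<not> special_corner s3"
  proof
    assume sp: "special_corner s3"
    obtain c q where cq: "s3 = (c, q)" by (cases s3)
    have c: "c \<in> F" "q < 2 * hf c" using c3 cq corner_iff by auto
    have "R (cell_rel c) ! (Suc q mod (2 * hf c)) \<noteq> R (cell_rel c) ! q"
      using special_letters_distinct[of "cell_rel c" q] c sp by (simp add: special_corner_def cq)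
    then show False
      using l c3 nxt_corner[OF c3] lt_side_R c by (simp add: cq nxt_eq)
  qed
  then show ?thesis
    using that[of s' s3] s3 ss' * l rung_deg(1)[OF r(1)] rung_deg(2)[OF r(2)] by (simp add: vert_def)
qed

lemma weight_le_3: "weight s \<le> 3"
  by (simp add: weight_def)

text \<open>In degree 2 there are no special corners. In degree 3 the weights are \<open>3 + 3 + 0\<close> if there is a full
  corner, and at most \<open>2 + 2 + 2\<close> otherwise. From degree 4 on, weights of at most 3 suffice.\<close>

lemma vertex_weight:
  assumes "deg v > 0"
  shows "sum weight (corners_at v) + 12 \<le> 6 * deg v"
proof -
  have "corners_at v \<noteq> {}" using card_corners_at[of v] assms by auto
  then obtain s0 where "s0 \<in> corners_at v" by blast
  then have d2: "deg v \<ge> 2" using deg_ge_2[of s0] by (auto simp: corners_at_def)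
  have vert: "vert s = v" "s \<in> corners" if "s \<in> corners_at v" for s
    using that by (auto simp: corners_at_def)
  consider "deg v = 2" | "deg v = 3" "\<exists>s \<in> corners_at v. full_corner s"
    | "deg v = 3" "\<not> (\<exists>s \<in> corners_at v. full_corner s)" | "deg v \<ge> 4"
    using d2 by linarith
  then show ?thesis
  proof cases
    case 1
    have "weight s = 0" if "s \<in> corners_at v" for s
      using special_corner_deg[of s] vert[OF that] 1 by (auto simp: weight_def)
    then show ?thesis using 1 by simp
  next
    case 2
    then obtain s where s: "s \<in> corners_at v" "full_corner s" by blast
    obtain s' s3 where *: "corners_at v = {s, s', s3}" "s \<noteq> s'" "s3 \<noteq> s" "s3 \<noteq> s'" "full_corner s'" "\<not> special_corner s3"
      by (rule full_at_degree_3[OF 2(1) s])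
    have "vert s3 = v" using vert *(1) by auto
    then have "weight s3 = 0" using *(6) 2 by (simp add: weight_def)
    moreover have "weight s = 3" "weight s' = 3" using s(2) *(5) by (auto simp: weight_def full_corner_def)
    ultimately show ?thesis using * 2 by simp
  next
    case 3
    have "weight s \<le> 2" if "s \<in> corners_at v" for s
      using that 3 by (auto simp: weight_def)
    then have "sum weight (corners_at v) \<le> card (corners_at v) * 2"
      using sum_bounded_above[of "corners_at v" weight 2] by simp
    then show ?thesis using 3 card_corners_at[of v] by simp
  next
    case 4
    have "sum weight (corners_at v) \<le> card (corners_at v) * 3"
      using sum_bounded_above[of "corners_at v" weight 3] weight_le_3 by simp
    then show ?thesis using 4 card_corners_at[of v] by simp
  qed
qed

text \<open>If all inner weights are 0, then an inner vertex of degree at least 3 has degree 3 and two full corners, and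
  \<open>full_at_degree_3\<close> applies to the inner corner. It makes the two letters equal and both adjacent
  vertices of degree at least 3, which spreads to the whole block. This forces the label to be a
  power of one letter.\<close>

lemma split_block_weight:
  assumes c: "c \<in> F" and j: "j < 2" and split: "\<not> full_block c j"
  shows "\<exists>m. 0 < m \<and> Suc m < hf c \<and> weight (c, j * hf c + m) = 2"
proof (rule ccontr)
  assume con: "\<not> ?thesis"
  let ?h = "hf c" and ?i = "cell_rel c"
  let ?s = "\<lambda>m. (c, j * ?h + m)"
  have corner: "?s m \<in> corners" if "m < ?h" for m
    using c j that by (auto simp: corner_iff less_2_cases_iff)
  have propagate: "lt (side (?s (Suc m))) = lt (side (?s m)) \<and>
      deg (vert (?s (m - 1))) \<ge> 3 \<and> deg (vert (?s (Suc m))) \<ge> 3"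
    if m: "0 < m" "Suc m < ?h" and d: "deg (vert (?s m)) \<ge> 3" for m
  proof -
    have cm: "?s m \<in> corners" "nxt (?s m) = ?s (Suc m)" using block_nxt[OF c j m(2)] by auto
    obtain p where p: "m = Suc p" using m(1) by (cases m) auto
    have prev: "?s p \<in> corners" "nxt (?s p) = ?s m" using block_nxt[OF c j, of p] m p by auto
    have ns: "\<not> special_corner (?s m)" using not_special_offset[OF m] by (simp add: special_corner_def)
    then have "weight (?s m) \<noteq> 2" using con m by blast
    then have d3: "deg (vert (?s m)) = 3" and "\<exists>s' \<in> corners_at (vert (?s m)). full_corner s'"
      using ns d by (auto simp: weight_def split: if_splits)
    then obtain s where s: "s \<in> corners_at (vert (?s m))" "full_corner s" by blast
    obtain s' s3 where *: "corners_at (vert (?s m)) = {s, s', s3}" "s \<noteq> s'" "s3 \<noteq> s" "s3 \<noteq> s'"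
      "full_corner s'" "\<not> special_corner s3"
      "lt (side (nxt s3)) = lt (side s3)" "deg (tail T (side s3)) \<ge> 3" "deg (vert (nxt s3)) \<ge> 3"
      by (rule full_at_degree_3[OF d3 s])
    have "?s m \<in> {s, s', s3}" using *(1) cm(1) by (auto simp: corners_at_def)
    moreover have "?s m \<noteq> s" "?s m \<noteq> s'" using ns s(2) *(5) by (auto simp: full_corner_def)
    ultimately have s3: "s3 = ?s m" by blast
    show ?thesis
      using *(7-9) cm(2) prev tail_side_nxt[OF prev(1)] unfolding s3 p by simp
  qed
  obtain m0 where m0: "0 < m0" "Suc m0 < ?h" "deg (vert (?s m0)) \<noteq> 2"
    using split unfolding full_block_def by blast
  have d0: "deg (vert (?s m0)) \<ge> 3" using m0(3) deg_ge_2[OF corner[of m0]] m0(2) by simp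
  have up: "deg (vert (?s m)) \<ge> 3" if "m0 \<le> m" "Suc m < ?h" for m
    using that
  proof (induction m rule: dec_induct)
    case base
    show ?case by (rule d0)
  next
    case (step n)
    then show ?case using propagate[of n] m0(1) by simp
  qed
  have down: "deg (vert (?s m)) \<ge> 3" if "m \<le> m0" "0 < m" for m
    using that
  proof (induction m rule: inc_induct)
    case base
    show ?case by (rule d0)
  next
    case (step n)
    then show ?case using propagate[of "Suc n"] m0(2) by simp
  qed
  have all: "deg (vert (?s m)) \<ge> 3" if "0 < m" "Suc m < ?h" for m
    using up down that by (cases "m \<le> m0") auto
  obtain k where k: "Suc k < ?h - 1" "block ?i j ! Suc k \<noteq> block ?i j ! k"
    using block_not_constant[of ?i j] c by auto
  have k': "Suc (Suc k) < ?h" using k(1) by linarith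
  have "lt (side (?s (Suc (Suc k)))) = lt (side (?s (Suc k)))"
    using propagate[of "Suc k"] all[of "Suc k"] k' by simp
  then have "R ?i ! (j * ?h + Suc (Suc k)) = R ?i ! (j * ?h + Suc k)"
    using lt_side_R[OF corner[of "Suc (Suc k)"]] lt_side_R[OF corner[of "Suc k"]] k' by simp
  then show False
    using R_block[OF j, of k ?i] R_block[OF j, of "Suc k" ?i] k k' by simp
qed

lemma block_weight:
  assumes c: "c \<in> F" and j: "j < 2"
  shows "6 \<le> (\<Sum>q \<in> {j * hf c..<j * hf c + hf c}. weight (c, q))"
proof -
  let ?h = "hf c"
  let ?b = "j * ?h" and ?e = "j * ?h + (?h - 1)"
  have h: "?h \<ge> 3" using hf_ge[OF c] .
  have sp: "special_corner (c, ?b)" "special_corner (c, ?e)" using h by (auto simp: special_corner_def special_def)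
  have le: "sum (\<lambda>q. weight (c, q)) A \<le> (\<Sum>q \<in> {?b..<?b + ?h}. weight (c, q))" if "A \<subseteq> {?b..<?b + ?h}" for A
    using that by (intro sum_mono2) auto
  show ?thesis
  proof (cases "full_block c j")
    case True
    then have "full_corner (c, ?b)" "full_corner (c, ?e)"
      using sp block_end_div[of j c] by (simp_all add: full_corner_def)
    then have "weight (c, ?b) = 3" "weight (c, ?e) = 3" using sp by (auto simp: weight_def)
    then show ?thesis using le[of "{?b, ?e}"] h by simp
  next
    case False
    obtain m where m: "0 < m" "Suc m < ?h" "weight (c, ?b + m) = 2"
      using split_block_weight[OF c j False] by blast
    have "weight (c, ?b) \<ge> 2" "weight (c, ?e) \<ge> 2" using sp by (auto simp: weight_def)
    moreover have "?b \<noteq> ?b + m" "?b \<noteq> ?e" "?b + m \<noteq> ?e" using m by linarith+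
    then have "(\<Sum>q \<in> {?b, ?b + m, ?e}. weight (c, q)) = weight (c, ?b) + weight (c, ?b + m) + weight (c, ?e)"
      by (simp del: add_diff_assoc)
    moreover have "{?b, ?b + m, ?e} \<subseteq> {?b..<?b + ?h}" using m by auto
    ultimately show ?thesis using le[of "{?b, ?b + m, ?e}"] m(3) by linarith
  qed
qed

text \<open>Up to a factor 2 this says that the Euler characteristic is at most 0, as every geometric edge consists of
  two arcs. The estimate at a vertex fails in degree 0, so isolated vertices are excluded.\<close>

lemma nonpositive_euler_char:
  assumes "\<And>v. v \<in> verts T \<Longrightarrow> out_arcs T v \<noteq> {}"
  shows "2 * card (verts T) + 2 * card F \<le> card (arcs T)"
proof -
  have "6 * (2 * card (verts T) + 2 * card F) \<le> 6 * card (arcs T)"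
  proof (rule combinatorial_gauss_bonnet[of weight])
    fix v assume "v \<in> verts T"
    then have "deg v > 0" using assms by (simp add: deg_def card_gt_0_iff)
    then show "sum weight (corners_at v) + 2 * 6 \<le> 6 * deg v" using vertex_weight by simp
  next
    fix c assume c: "c \<in> F"
    have "(\<Sum>q < length (bd c). weight (c, q)) =
        (\<Sum>j < 2. \<Sum>q \<in> {j * hf c..<j * hf c + hf c}. weight (c, q))"
      using sum.nat_group[of "\<lambda>q. weight (c, q)" "hf c" 2] c by simp
    moreover have "(\<Sum>j < 2. \<Sum>q \<in> {j * hf c..<j * hf c + hf c}. weight (c, q)) \<ge> (\<Sum>j < (2::nat). 6)"
      using block_weight[OF c] by (intro sum_mono) auto
    ultimately show "2 * 6 \<le> (\<Sum>q < length (bd c). weight (c, q))" by simp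
  qed
  then show ?thesis by simp
qed

end

section \<open>Boundary paths read along the image cells\<close>

lemma cas_adjacent:
  assumes "pre_digraph.cas G u es v" "es \<noteq> []"
  shows "tail G (es ! 0) = u \<and> head G (es ! (length es - 1)) = v \<and>
    (\<forall>k. Suc k < length es \<longrightarrow> head G (es ! k) = tail G (es ! Suc k))"
  using assms
proof (induction es arbitrary: u)
  case (Cons e es)
  have c: "tail G e = u" "pre_digraph.cas G (head G e) es v"
    using Cons.prems by (auto simp: pre_digraph.cas.simps)
  show ?case
  proof (cases "es = []")
    case True
    then show ?thesis using c by (simp add: pre_digraph.cas.simps)
  next
    case False
    note IH = Cons.IH[OF c(2) False]
    have "head G ((e # es) ! k) = tail G ((e # es) ! Suc k)" if "Suc k < length (e # es)" for k
    proof (cases k)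
      case 0
      then show ?thesis using IH by (simp only: nth_Cons_0 nth_Cons_Suc)
    next
      case (Suc l)
      then show ?thesis using IH that by (simp only: nth_Cons_Suc length_Cons Suc_less_eq)
    qed
    moreover have "(e # es) ! (length (e # es) - 1) = es ! (length es - 1)"
      using False by (simp add: nth_Cons')
    ultimately show ?thesis using IH c(1) by (auto simp only: nth_Cons_0)
  qed
qed simp

lemma boundary_closed:
  assumes "is_complex2 C" "c \<in> cells C" "p < length (bdry C c)"
  shows "head (skel C) (bdry C c ! p) = tail (skel C) (bdry C c ! (Suc p mod length (bdry C c)))"
    and "bdry C c ! p \<in> arcs (skel C)"
proof -
  obtain v where v: "pre_digraph.awalk (skel C) v (bdry C c) v"
    using assms(1,2) by (auto simp: is_complex2_def)
  then have cas: "pre_digraph.cas (skel C) v (bdry C c) v" and sub: "set (bdry C c) \<subseteq> arcs (skel C)"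
    by (auto simp: pre_digraph.awalk_def)
  have "bdry C c \<noteq> []" using assms(3) by auto
  note adj = cas_adjacent[OF cas this]
  show "bdry C c ! p \<in> arcs (skel C)" using sub assms(3) by auto
  show "head (skel C) (bdry C c ! p) = tail (skel C) (bdry C c ! (Suc p mod length (bdry C c)))"
  proof (cases "Suc p < length (bdry C c)")
    case True
    then show ?thesis using adj by (simp only: mod_less)
  next
    case False
    then have e: "Suc p = length (bdry C c)" using assms(3) by simp
    have "bdry C c ! (Suc p mod length (bdry C c)) = bdry C c ! 0"
      "bdry C c ! p = bdry C c ! (length (bdry C c) - 1)"
      by (simp_all flip: e)
    then show ?thesis using adj by (simp only:)
  qed
qed

lemma inj_on_nat_shift_mod: "inj_on (\<lambda>p. (a + p) mod n) {..<n :: nat}"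
proof (rule inj_onI)
  fix p q assume pq: "p \<in> {..<n}" "q \<in> {..<n}" and eq: "(a + p) mod n = (a + q) mod n"
  have "x = y" if "x \<le> y" "y < n" "(a + x) mod n = (a + y) mod n" for x y
  proof -
    have "n dvd (a + y) - (a + x)" using mod_eq_dvd_iff_nat[of "a + x" "a + y" n] that by simp
    then show ?thesis using that by (auto dest: dvd_imp_le)
  qed
  from this[of p q] this[of q p, symmetric] show "p = q"
    using pq eq by (metis lessThan_iff linorder_le_cases)
qed

lemma side_image_less: "p < length (bdry C c) \<Longrightarrow> side_image f C c p < length (bdry C c)"
proof -
  assume "p < length (bdry C c)"
  then have "m mod length (bdry C c) < length (bdry C c)" for m
    by (intro mod_less_divisor) linarith
  then show ?thesis
    by (cases "keeps_orient f c") (simp_all only: side_image_def Let_def if_True if_False)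
qed

lemma side_image_Suc:
  assumes "p < length (bdry C c)"
  defines "n \<equiv> length (bdry C c)"
  shows "keeps_orient f c \<Longrightarrow> side_image f C c (Suc p mod n) = Suc (side_image f C c p) mod n"
    and "\<not> keeps_orient f c \<Longrightarrow> Suc (side_image f C c (Suc p mod n)) mod n = side_image f C c p"
proof -
  show "side_image f C c (Suc p mod n) = Suc (side_image f C c p) mod n" if "keeps_orient f c"
    unfolding side_image_def Let_def n_def[symmetric]
    by (simp only: that if_True mod_add_right_eq mod_Suc_eq add_Suc_right)
  show "Suc (side_image f C c (Suc p mod n)) mod n = side_image f C c p" if "\<not> keeps_orient f c"
  proof (cases "Suc p = n")
    case True
    then have "side_image f C c (Suc p mod n) = (shift f c + n) mod n"
      using that by (simp add: side_image_def Let_def flip: n_def)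
    then have "Suc (side_image f C c (Suc p mod n)) mod n = Suc (shift f c + n) mod n"
      by (simp only: mod_Suc_eq)
    also have "Suc (shift f c + n) = shift f c + (n - p) + n" using True by linarith
    also have "\<dots> mod n = side_image f C c p"
      using that by (simp only: side_image_def Let_def n_def if_False mod_add_self2)
    finally show ?thesis .
  next
    case False
    then have p: "Suc p < n" using assms by simp
    then have "side_image f C c (Suc p mod n) = (shift f c + (n - Suc p)) mod n"
      using that by (simp add: side_image_def Let_def n_def)
    then have "Suc (side_image f C c (Suc p mod n)) mod n = Suc (shift f c + (n - Suc p)) mod n"
      by (simp only: mod_Suc_eq)
    also have "Suc (shift f c + (n - Suc p)) = shift f c + (n - p)" using p by linarith
    also have "\<dots> mod n = side_image f C c p"
      using that by (simp add: side_image_def Let_def n_def)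
    finally show ?thesis .
  qed
qed

lemma bij_side_image:
  "bij_betw (side_image f C c) {..<length (bdry C c)} {..<length (bdry C c)}"
proof -
  let ?n = "length (bdry C c)"
  have inj: "inj_on (side_image f C c) {..<?n}"
  proof (cases "keeps_orient f c")
    case True
    then have "side_image f C c = (\<lambda>p. (shift f c + p) mod ?n)"
      by (simp add: side_image_def Let_def fun_eq_iff)
    then show ?thesis by (simp only: inj_on_nat_shift_mod)
  next
    case False
    have e: "shift f c + 1 + (?n - Suc p) = shift f c + (?n - p)" if "p < ?n" for p
      using that by simp
    show ?thesis
    proof (rule inj_onI)
      fix p q assume pq: "p \<in> {..<?n}" "q \<in> {..<?n}"
        and "side_image f C c p = side_image f C c q"
      then have "(shift f c + (?n - p)) mod ?n = (shift f c + (?n - q)) mod ?n"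
        using False unfolding side_image_def Let_def by simp
      then have "(shift f c + 1 + (?n - Suc p)) mod ?n = (shift f c + 1 + (?n - Suc q)) mod ?n"
        using pq by (simp only: e lessThan_iff)
      then have "?n - Suc p = ?n - Suc q"
        by (rule inj_onD[OF inj_on_nat_shift_mod]) (use pq in auto)
      then show "p = q" using pq by auto
    qed
  qed
  moreover have "side_image f C c ` {..<?n} = {..<?n}"
    by (rule endo_inj_surj) (use inj side_image_less[of _ C c f] in auto)
  ultimately show ?thesis by (simp add: bij_betw_def)
qed

text \<open>The boundary path of \<open>c\<close>, started and directed such that its \<open>q\<close>-th arc maps to the \<open>q\<close>-th arc of the boundary
  path of the image cell.\<close>

definition pulled_bdry ::
  "('v, 'e, 'c, 'v2, 'e2, 'c2) cell_map \<Rightarrow> ('v, 'e, 'c) complex2 \<Rightarrow> 'c \<Rightarrow> 'e list" where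
  "pulled_bdry f C c = map (\<lambda>q. let a = bdry C c ! inv_into {..<length (bdry C c)} (side_image f C c) q
     in if keeps_orient f c then a else rev_arc C a) [0..<length (bdry C c)]"

lemma length_pulled_bdry [simp]: "length (pulled_bdry f C c) = length (bdry C c)"
  by (simp add: pulled_bdry_def)

lemma nth_pulled_bdry:
  assumes "p < length (bdry C c)"
  shows "pulled_bdry f C c ! side_image f C c p =
    (if keeps_orient f c then bdry C c ! p else rev_arc C (bdry C c ! p))"
proof -
  have "inv_into {..<length (bdry C c)} (side_image f C c) (side_image f C c p) = p"
    using bij_betw_imp_inj_on[OF bij_side_image] by (rule inv_into_f_f) (use assms in simp)
  then show ?thesis
    using side_image_less[OF assms, of f] by (simp add: pulled_bdry_def)
qed

lemma side_image_cases:
  assumes "q < length (bdry C c)"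
  obtains p where "p < length (bdry C c)" "q = side_image f C c p"
proof -
  have "q \<in> side_image f C c ` {..<length (bdry C c)}"
    using assms bij_side_image[of f C c] by (simp add: bij_betw_def)
  then show ?thesis using that by blast
qed

text \<open>The rewritten boundary paths run along the same edges as the old ones, so surfaces and reduced
  maps keep their defining properties.\<close>

lemma labelled_diagram_pulled_bdry:
  fixes P :: "('x, 'i) presentation"
  assumes surf: "closed_surface C" and map: "combinatorial_map f C (standard_complex P)"
    and red: "reduced_map f C"
    and cyc: "\<And>i. i \<in> rels P \<Longrightarrow> cyclically_reduced (relator P i)"
  shows "labelled_diagram (skel C) (rev_arc C) P (cells C) (pulled_bdry f C) (on_arcs f) (on_cells f)"
proof -
  let ?K = "standard_complex P" and ?G = "skel C" and ?rv = "rev_arc C"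
  have cx: "is_complex2 C" and fin: "finite_complex2 C"
    and two: "\<And>e. e \<in> arcs ?G \<Longrightarrow> card {(c, p) \<in> sides C. bdry C c ! p \<in> {e, ?rv e}} = 2"
    using surf by (auto simp: closed_surface_def)
  interpret bidirected_digraph ?G ?rv using cx by (simp add: is_complex2_def)
  have revK: "rev_arc ?K (rev_arc ?K l) = l" for l
    by (simp add: standard_complex_def inv_letter_def)
  have arcK: "rev_arc ?K (on_arcs f a) = inv_letter (on_arcs f a)" if "a \<in> arcs ?G" for a
  proof -
    have "on_arcs f a \<in> arcs (skel ?K)" using map that by (simp add: combinatorial_map_def)
    then have "fst (on_arcs f a) \<in> gens P" by (auto simp: standard_complex_def)
    then show ?thesis by (simp add: standard_complex_def)
  qed
  have revf: "on_arcs f (?rv a) = rev_arc ?K (on_arcs f a)" if "a \<in> arcs ?G" for a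
    using map that by (simp add: combinatorial_map_def)
  have cellK: "on_cells f c \<in> rels P" "length (relator P (on_cells f c)) = length (bdry C c)"
    if "c \<in> cells C" for c
    using map that by (auto simp: combinatorial_map_def standard_complex_def)
  have sideK: "on_arcs f (bdry C c ! p) =
      (let e = relator P (on_cells f c) ! side_image f C c p
       in if keeps_orient f c then e else rev_arc ?K e)"
    if "c \<in> cells C" "p < length (bdry C c)" for c p
    using map that unfolding combinatorial_map_def Let_def
    by (simp add: standard_complex_def)
  have edge: "{bd, ?rv bd} = {bdry C c ! p, ?rv (bdry C c ! p)}"
    if "bd = pulled_bdry f C c ! side_image f C c p" "p < length (bdry C c)" for bd c p
    using that by (auto simp: nth_pulled_bdry)
  show ?thesis
  proof
    show "finite (verts ?G)" "finite (arcs ?G)" "finite (cells C)"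
      using fin by (auto simp: finite_complex2_def)
  next
    fix c assume c: "c \<in> cells C"
    show "on_cells f c \<in> rels P" by (rule cellK[OF c])
    show "pulled_bdry f C c \<noteq> []" 
    proof -
      have "bdry C c \<noteq> []" using cx c by (simp add: is_complex2_def)
      then show ?thesis by (metis length_0_conv length_pulled_bdry)
    qed
    show "map (on_arcs f) (pulled_bdry f C c) = relator P (on_cells f c)"
    proof (rule nth_equalityI)
      fix q assume "q < length (map (on_arcs f) (pulled_bdry f C c))"
      then have q: "q < length (bdry C c)" by simp
      then obtain p where p: "p < length (bdry C c)" "q = side_image f C c p"
        by (rule side_image_cases)
      show "map (on_arcs f) (pulled_bdry f C c) ! q = relator P (on_cells f c) ! q"
      proof (cases "keeps_orient f c")
        case True
        then show ?thesis
          using sideK[OF c p(1)] nth_pulled_bdry[OF p(1), of f] q p(2) by simp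
      next
        case False
        then have "on_arcs f (pulled_bdry f C c ! q) = rev_arc ?K (on_arcs f (bdry C c ! p))"
          using nth_pulled_bdry[OF p(1), of f] revf[OF boundary_closed(2)[OF cx c p(1)]] p(2) by simp
        also have "\<dots> = relator P (on_cells f c) ! q"
          using sideK[OF c p(1)] False p(2) revK by simp
        finally show ?thesis using q by simp
      qed
    qed (simp add: cellK[OF c])
    show "set (pulled_bdry f C c) \<subseteq> arcs ?G"
    proof
      fix a assume "a \<in> set (pulled_bdry f C c)"
      then obtain q where q: "q < length (bdry C c)" "a = pulled_bdry f C c ! q"
        by (auto simp: in_set_conv_nth)
      obtain p where p: "p < length (bdry C c)" "q = side_image f C c p"
        using q(1) by (rule side_image_cases)
      show "a \<in> arcs ?G"
        using boundary_closed(2)[OF cx c p(1)] nth_pulled_bdry[OF p(1), of f] q(2) p(2)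
        by (simp split: if_splits)
    qed
    fix q assume "q < length (pulled_bdry f C c)"
    then have q: "q < length (bdry C c)" by simp
    let ?n = "length (bdry C c)" and ?b = "bdry C c" and ?s = "side_image f C c"
    show "head ?G (pulled_bdry f C c ! q) =
        tail ?G (pulled_bdry f C c ! (Suc q mod length (pulled_bdry f C c)))"
    proof (cases "keeps_orient f c")
      case True
      obtain p where p: "p < ?n" "q = ?s p" using q by (rule side_image_cases)
      have p': "Suc p mod ?n < ?n" using p(1) by (intro mod_less_divisor) linarith
      have nq: "Suc q mod ?n = ?s (Suc p mod ?n)" using side_image_Suc(1)[OF p(1) True] p(2) by simp
      have "pulled_bdry f C c ! q = ?b ! p"
        using nth_pulled_bdry[OF p(1), of f] True p(2) by simp
      moreover have "pulled_bdry f C c ! (Suc q mod ?n) = ?b ! (Suc p mod ?n)"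
        unfolding nq using nth_pulled_bdry[OF p', of f] True by simp
      ultimately show ?thesis
        by (simp only: length_pulled_bdry boundary_closed(1)[OF cx c p(1)])
    next
      case False
      have "Suc q mod ?n < ?n" using q by (intro mod_less_divisor) linarith
      then obtain p where p: "p < ?n" "Suc q mod ?n = ?s p" by (rule side_image_cases)
      have p': "Suc p mod ?n < ?n" using p(1) by (intro mod_less_divisor) linarith
      have "(1 + ?s (Suc p mod ?n)) mod ?n = (1 + q) mod ?n"
        using side_image_Suc(2)[OF p(1) False] p(2) by simp
      then have s: "?s (Suc p mod ?n) = q"
        by (rule inj_onD[OF inj_on_nat_shift_mod]) (use side_image_less[OF p', of f] q in auto)
      have "pulled_bdry f C c ! q = ?rv (?b ! (Suc p mod ?n))"
        using nth_pulled_bdry[OF p', of f] False s by simp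
      moreover have "pulled_bdry f C c ! (Suc q mod ?n) = ?rv (?b ! p)"
        unfolding p(2) using nth_pulled_bdry[OF p(1), of f] False by simp
      ultimately show ?thesis
        using boundary_closed(1)[OF cx c p(1)] boundary_closed(2)[OF cx c p(1)]
          boundary_closed(2)[OF cx c p']
        by (simp only: length_pulled_bdry head_arev tail_arev)
    qed
  next
    fix a assume a: "a \<in> arcs ?G"
    let ?S = "{(c, p) \<in> sides C. bdry C c ! p \<in> {a, ?rv a}}"
    let ?S' = "{(c, q). c \<in> cells C \<and> q < length (pulled_bdry f C c) \<and> pulled_bdry f C c ! q \<in> {a, ?rv a}}"
    let ?h = "\<lambda>(c, p). (c, side_image f C c p)"
    have same: "pulled_bdry f C c ! side_image f C c p \<in> {a, ?rv a} \<longleftrightarrow> bdry C c ! p \<in> {a, ?rv a}"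
      if "p < length (bdry C c)" for c p
    proof -
      have "?rv b = a \<longleftrightarrow> b = ?rv a" "?rv b = ?rv a \<longleftrightarrow> b = a" for b by (metis arev_arev)+
      then have "?rv b \<in> {a, ?rv a} \<longleftrightarrow> b \<in> {a, ?rv a}" for b by blast
      then show ?thesis by (simp only: nth_pulled_bdry[OF that, of f] split: if_split) blast
    qed
    have "inj_on ?h ?S"
    proof (rule inj_onI)
      fix x y assume x: "x \<in> ?S" and y: "y \<in> ?S" and eq: "?h x = ?h y"
      obtain c p p' where xy: "x = (c, p)" "y = (c, p')" using eq by (cases x; cases y) auto
      have less: "p < length (bdry C c)" "p' < length (bdry C c)"
        using x y xy by (auto simp: sides_def)
      have "side_image f C c p = side_image f C c p'" using eq xy by simp
      then have "p = p'"
        by (rule inj_onD[OF bij_betw_imp_inj_on[OF bij_side_image]]) (simp_all add: less)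
      then show "x = y" using xy by simp
    qed
    moreover have "?h ` ?S = ?S'"
    proof
      show "?h ` ?S \<subseteq> ?S'"
      proof
        fix x assume "x \<in> ?h ` ?S"
        then obtain y where y: "x = ?h y" "y \<in> ?S" by (rule imageE)
        obtain c p where "y = (c, p)" by (cases y)
        then have x: "x = (c, side_image f C c p)" "(c, p) \<in> sides C"
          "bdry C c ! p \<in> {a, ?rv a}" using y by auto
        then have p: "c \<in> cells C" "p < length (bdry C c)" by (auto simp: sides_def)
        show "x \<in> ?S'"
          using x(1,3) p(1) same[OF p(2)] side_image_less[OF p(2), of f] by simp
      qed
      show "?S' \<subseteq> ?h ` ?S"
      proof
        fix x assume "x \<in> ?S'"
        then obtain c q where x: "x = (c, q)" "c \<in> cells C" "q < length (bdry C c)"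
          "pulled_bdry f C c ! q \<in> {a, ?rv a}" by auto
        obtain p where p: "p < length (bdry C c)" "q = side_image f C c p"
          using x(3) by (rule side_image_cases)
        then have "(c, p) \<in> ?S" using same[OF p(1)] x by (simp add: sides_def)
        then have "?h (c, p) \<in> ?h ` ?S" by (rule imageI)
        then show "x \<in> ?h ` ?S" using x(1) p(2) by simp
      qed
    qed
    ultimately show "card ?S' = 2" using card_image[of ?h ?S] two[OF a] by simp
    show "on_arcs f (?rv a) = inv_letter (on_arcs f a)" using revf[OF a] arcK[OF a] by simp
  next
    fix c c' q
    assume c: "c \<in> cells C" "c' \<in> cells C" "on_cells f c = on_cells f c'"
      and q: "q < length (pulled_bdry f C c)"
      and e: "pulled_bdry f C c' ! q \<in> {pulled_bdry f C c ! q, ?rv (pulled_bdry f C c ! q)}"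
    have q1: "q < length (bdry C c)" using q by simp
    have q2: "q < length (bdry C c')" using q cellK(2)[OF c(1)] cellK(2)[OF c(2)] c(3) by simp
    obtain p where p: "p < length (bdry C c)" "q = side_image f C c p"
      using q1 by (rule side_image_cases)
    obtain p' where p': "p' < length (bdry C c')" "q = side_image f C c' p'"
      using q2 by (rule side_image_cases)
    have "{pulled_bdry f C c ! q, ?rv (pulled_bdry f C c ! q)} =
        {pulled_bdry f C c' ! q, ?rv (pulled_bdry f C c' ! q)}"
      using e by (elim insertE emptyE) (simp_all add: insert_commute)
    then have "{bdry C c ! p, ?rv (bdry C c ! p)} = {bdry C c' ! p', ?rv (bdry C c' ! p')}"
      using edge[OF refl p(1)] edge[OF refl p'(1)] p(2) p'(2) by simp
    then have share: "bdry C c' ! p' \<in> {bdry C c ! p, ?rv (bdry C c ! p)}" by (metis insertI1)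
    have sides: "(c, p) \<in> sides C" "(c', p') \<in> sides C" using c p p' by (simp_all add: sides_def)
    show "c = c'"
    proof (rule ccontr)
      assume neq: "c \<noteq> c'"
      have "\<exists>(c, p) \<in> sides C. \<exists>(c', p') \<in> sides C. c \<noteq> c' \<and>
          bdry C c' ! p' \<in> {bdry C c ! p, rev_arc C (bdry C c ! p)} \<and>
          on_cells f c = on_cells f c' \<and> side_image f C c p = side_image f C c' p'"
        by (rule bexI[OF _ sides(1)], simp only: prod.case, rule bexI[OF _ sides(2)])
          (use neq share c(3) p(2) p'(2) in simp)
      then show False using red unfolding reduced_map_def by (rule notE[rotated])
    qed
  next
    fix i assume "i \<in> rels P"
    then show "cyclically_reduced (relator P i)" by (rule cyc)
  qed
qed

section \<open>Spherical diagrams\<close>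

lemma card_arcs_geom_edges:
  assumes "bidirected_digraph (skel C) (rev_arc C)" "finite (arcs (skel C))"
  shows "card (arcs (skel C)) = 2 * card (geom_edges C)"
proof -
  interpret bidirected_digraph "skel C" "rev_arc C" by fact
  let ?A = "arcs (skel C)" and ?g = "\<lambda>e. {e, rev_arc C e}"
  have "card {e \<in> ?A. ?g e = E} = 2" if E: "E \<in> geom_edges C" for E
  proof -
    obtain a where a: "a \<in> ?A" "E = ?g a" using E unfolding geom_edges_def by blast
    have "{e \<in> ?A. ?g e = E} = {a, rev_arc C a}"
    proof
      show "{e \<in> ?A. ?g e = E} \<subseteq> {a, rev_arc C a}" using a(2) by blast
      have "?g (rev_arc C a) = ?g a" by (simp add: insert_commute)
      then show "{a, rev_arc C a} \<subseteq> {e \<in> ?A. ?g e = E}" using a by simp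
    qed
    then show ?thesis using arev_neq[OF a(1)] by simp
  qed
  moreover have "card ?A = (\<Sum>E \<in> ?g ` ?A. card {e \<in> ?A. ?g e = E})"
    using sum.image_gen[OF assms(2), of "\<lambda>_. 1 :: nat" ?g] by simp
  ultimately show ?thesis by (simp add: geom_edges_def)
qed

text \<open>By connectedness an isolated vertex would be the whole complex, of Euler characteristic 1.\<close>

lemma sphere_no_isolated_vertex:
  assumes sphere: "sphere_decomposition C" and v: "v \<in> verts (skel C)"
  shows "out_arcs (skel C) v \<noteq> {}"
proof
  assume none: "out_arcs (skel C) v = {}"
  have cx: "is_complex2 C" and con: "Digraph_Component.connected (skel C)" and chi: "euler_char C = 2"
    using sphere by (auto simp: sphere_decomposition_def closed_surface_def)
  interpret bidirected_digraph "skel C" "rev_arc C" using cx by (simp add: is_complex2_def)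
  have "u = v" if u: "u \<in> verts (skel C)" for u
  proof -
    have "v \<rightarrow>\<^sup>*\<^bsub>mk_symmetric (skel C)\<^esub> u"
      using con v u by (auto simp: Digraph_Component.connected_def strongly_connected_def)
    then have "v \<rightarrow>\<^sup>*\<^bsub>skel C\<^esub> u" using reachable_mk_symmetric_eq[OF sym_arcs] by simp
    then show "u = v"
    proof (cases rule: converse_reachable_cases)
      case (step w)
      then show ?thesis using none by (auto simp: out_arcs_def)
    qed auto
  qed
  then have verts: "verts (skel C) = {v}" using v by blast
  have arcs: "arcs (skel C) = {}"
  proof (rule equals0I)
    fix a assume a: "a \<in> arcs (skel C)"
    then have "tail (skel C) a = v" using tail_in_verts verts by blast
    then show False using a none by (simp add: out_arcs_def)
  qed
  have "cells C = {}"
  proof (rule ccontr)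
    assume "cells C \<noteq> {}"
    then obtain c where c: "c \<in> cells C" by blast
    then have "bdry C c \<noteq> []" using cx by (simp add: is_complex2_def)
    then show False using boundary_closed(2)[OF cx c, of 0] arcs by simp
  qed
  then show False using chi verts arcs by (simp add: euler_char_def geom_edges_def)
qed

theorem theorem2p1:
  fixes G :: "('x, 'e) word_labeled_graph"
  assumes "is_wlog G"
    and "injective_wlog G"
    and "\<forall>e \<in> arcs (graph_of G). length (label G e) \<ge> 2"
    and "\<forall>e \<in> arcs (graph_of G). cyclically_reduced (wlog_relator G e)"
    and "\<forall>e \<in> arcs (graph_of G).
           \<not> piece (wlog_presentation G) [initial_letter G e, hd (label G e)] \<and>
           \<not> piece (wlog_presentation G) [inv_letter (hd (label G e)), initial_letter G e] \<and>
           \<not> piece (wlog_presentation G) [terminal_letter G e, inv_letter (last (label G e))] \<and>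
           \<not> piece (wlog_presentation G) [last (label G e), terminal_letter G e]"
    and "\<forall>e \<in> arcs (graph_of G). \<not> (\<exists>x s m. m \<ge> 2 \<and> label G e = replicate m (x, s))"
  shows "diagrammatically_reducible (standard_complex (wlog_presentation G))"
  unfolding diagrammatically_reducible_def
proof (intro notI, elim exE conjE)
  fix C :: "(nat, nat, nat) complex2"
    and f :: "(nat, nat, nat, unit, 'x letter, 'e) cell_map"
  assume sphere: "sphere_decomposition C"
    and map: "combinatorial_map f C (standard_complex (wlog_presentation G))"
    and red: "reduced_map f C"
  have wlog: "wlog_conditions G"
    using assms by (intro wlog_conditions.intro) blast+
  have surf: "closed_surface C" using sphere by (simp add: sphere_decomposition_def)
  have "labelled_diagram (skel C) (rev_arc C) (wlog_presentation G) (cells C) (pulled_bdry f C)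
      (on_arcs f) (on_cells f)"
    using labelled_diagram_pulled_bdry[OF surf map red] assms(4) by (simp add: wlog_presentation_def)
  with wlog interpret wlog_diagram G "skel C" "rev_arc C" "cells C" "pulled_bdry f C" "on_arcs f" "on_cells f"
    by (rule wlog_diagram.intro)
  have "2 * card (verts (skel C)) + 2 * card (cells C) \<le> card (arcs (skel C))"
    using sphere_no_isolated_vertex[OF sphere] by (rule nonpositive_euler_char)
  also have "\<dots> = 2 * card (geom_edges C)"
    using bidirected_digraph finite_T(2) by (rule card_arcs_geom_edges)
  finally have "euler_char C \<le> 0" by (simp add: euler_char_def)
  then show False using sphere by (simp add: sphere_decomposition_def)
qed

end
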